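(* (1) The set $\{M_\alpha:\alpha \text{ a weak composition}\}$ is a $\mathbf k$-basis of $\mathrm{RenQSym}$. (2) The $\mathbf k$-algebras $\mathrm{RenQSym}$ and $\mathrm{QS}(\mathbb N)$ are isomorphic.
   Context: $\mathbf k$ is a commutative ring containing $\mathbb Q$. $\mathbb P$ and $\mathbb N$ denote positive and nonnegative integers. A weak composition is a finite sequence of nonnegative integers, possibly empty; it is left weak if it is empty or its last entry is positive. Let $X=\{x_i:i\in\mathbb P\}$ be commuting indeterminates. The algebra $\mathrm{QS}(\mathbb N)$. It is the free $\mathbf k$-module with basis all weak compositions. The product is the quasi-shuffle product $*$: $\emptyset$ is the unit, and $$a*b=(a_1,(a_2,\dots,a_m)*b)+(b_1,a*(b_2,\dots,b_n))+(a_1+b_1,(a_2,\dots,a_m)*(b_2,\dots,b_n)),$$ with $(c,\sum\lambda_uu)=\sum\lambda_u(c,u)$. For left weak $\alpha$, $M_\alpha=\sum_{0<i_1<\cdots<i_k}x_{i_1}^{\alpha_1}\cdots x_{i_k}^{\alpha_k}$ ($M_\emptyset=1$). GSym. $\mathrm{GSym}$ is the $\mathbb Q$-span of $\widehat M_{\binom{\gamma}{\mu}}=\sum_{0<i_1<\cdots<i_r}\prod_l i_l^{\mu_l}x_{i_l}^{\gamma_l}$, for $\gamma$ left weak and $\mu\in\mathbb N^r$. Regularization. For $\alpha\in\mathbb N^k$, $\beta\in\mathbb P^k$, $\phi\binom{\alpha}{\beta}\in\mathrm{GSym}[t][z^{-1},z]]$ is obtained from $\sum_{0<i_1<\cdots<i_k}\prod_lx_{i_l}^{\alpha_l}e^{(i_l+t)\beta_lz}$.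 The coefficient of each $X$-monomial converges for $t\ge0$, $\mathrm{Re}(z)<0$; it is expanded as a Laurent series in $z$ with coefficients in $\mathbb Q[t]$, and powers are collected. Renormalization. Let $P$ be the polar-part projection in $z$. Set $\phi_-(\emptyset)=1$ and $E=\phi\binom{\alpha}{\beta}+\sum_{i=1}^{k-1}\phi\binom{\alpha_1..\alpha_i}{\beta_1..\beta_i}\phi_-\binom{\alpha_{i+1}..\alpha_k}{\beta_{i+1}..\beta_k}$. Then $\phi_-\binom{\alpha}{\beta}=-P(E)$, $\phi_+\binom{\alpha}{\beta}=(\mathrm{id}-P)(E)$, and $Z\binom{\alpha}{\beta}=\phi_+\binom{\alpha}{\beta}|_{z=0}$. For any weak composition $\alpha$ of length $k$, $M_\alpha:=Z\binom{\alpha}{\delta,\dots,\delta}$ with $\delta\in\mathbb P$. This is independent of $\delta$ and agrees with the series above for left weak $\alpha$. $\mathrm{RenQSym}$ is the $\mathbf k$-span of all $M_\alpha$ in $\mathbf k[[X]][t]$; it is closed under multiplication. *)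

theory Defs
  imports "HOL-Complex_Analysis.Complex_Analysis" "HOL-Library.Poly_Mapping"
    "HOL-Library.Multiset" "HOL-Computational_Algebra.Polynomial"
begin

type_synonym monom = "nat \<Rightarrow>\<^sub>0 nat"

definition mono_of :: "nat list \<Rightarrow> nat list \<Rightarrow> monom" where
  "mono_of i a = (\<Sum>l<length a. Poly_Mapping.single (i ! l) (a ! l))"

definition idx_set :: "nat list \<Rightarrow> monom \<Rightarrow> nat list set" where
  "idx_set a m = {i. length i = length a \<and> sorted_wrt (<) i \<and> (\<forall>x\<in>set i. 0 < x)
                     \<and> mono_of i a = m}"

text \<open>Coefficient of X^m in sum_{i} prod_l x_{i_l}^{a_l} e^{(i_l+t) b_l z}, as function of z
  (convergent for Re z < 0). Argument ab is the list of columns (a_l, b_l).\<close>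
definition phi_fun :: "real \<Rightarrow> (nat \<times> nat) list \<Rightarrow> monom \<Rightarrow> complex \<Rightarrow> complex" where
  "phi_fun t ab m z = infsum (\<lambda>i. exp (\<Sum>l<length ab.
       (of_nat (i ! l) + complex_of_real t) * of_nat (snd (ab ! l)) * z))
     (idx_set (map fst ab) m)"

type_synonym ser = "monom \<Rightarrow> complex fls"

text \<open>Laurent expansion at z = 0 (of the meromorphic continuation from Re z < 0).\<close>
definition phi :: "real \<Rightarrow> (nat \<times> nat) list \<Rightarrow> ser" where
  "phi t ab m = (THE F. 0 < fls_conv_radius F \<and>
       (\<forall>\<^sub>F z in at 0. Re z < 0 \<longrightarrow> eval_fls F z = phi_fun t ab m z))"

definition ser_mult :: "ser \<Rightarrow> ser \<Rightarrow> ser" where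
  "ser_mult f g m = (\<Sum>p\<in>{(m1, m2). m1 + m2 = m}. f (fst p) * g (snd p))"

definition ser_one :: ser where
  "ser_one m = (if m = 0 then 1 else 0)"

definition polar :: "ser \<Rightarrow> ser" where
  "polar f m = f m - fps_to_fls (fls_regpart (f m))"

function phi_minus :: "real \<Rightarrow> (nat \<times> nat) list \<Rightarrow> ser" where
  "phi_minus t ab = (if ab = [] then ser_one else
     (\<lambda>m. - polar (\<lambda>m. phi t ab m + sum_list (map (\<lambda>i. ser_mult (phi t (take i ab))
          (phi_minus t (drop i ab)) m) [1..<length ab])) m))"
  by pat_completeness auto
termination
  by (relation "Wellfounded.measure (\<lambda>(t, ab). length ab)") auto

definition renE :: "real \<Rightarrow> (nat \<times> nat) list \<Rightarrow> ser" where
  "renE t ab m = phi t ab m + sum_list (map (\<lambda>i. ser_mult (phi t (take i ab))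
          (phi_minus t (drop i ab)) m) [1..<length ab])"

definition phi_plus :: "real \<Rightarrow> (nat \<times> nat) list \<Rightarrow> ser" where
  "phi_plus t ab m = renE t ab m - polar (renE t ab) m"

definition Zval :: "real \<Rightarrow> (nat \<times> nat) list \<Rightarrow> monom \<Rightarrow> complex" where
  "Zval t ab m = fls_nth (phi_plus t ab m) 0"

text \<open>M_alpha := Z(alpha; delta...delta) with delta = 1; coefficient of X^m as element of Q[t].\<close>
definition Mrat :: "nat list \<Rightarrow> monom \<Rightarrow> rat poly" where
  "Mrat a m = (THE p. \<forall>t::real. 0 \<le> t \<longrightarrow>
       poly (map_poly of_rat p) (complex_of_real t) = Zval t (map (\<lambda>x. (x, 1)) a) m)"

section \<open>Scalars: a commutative ring k containing Q\<close>

definition ratk :: "rat \<Rightarrow> 'k::comm_ring_1" where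
  "ratk q = (case quotient_of q of (a, b) \<Rightarrow> of_int a * (THE y. of_int b * y = 1))"

text \<open>Elements of k[[X]][t] represented by coefficient functions: monomial, power of t.\<close>
type_synonym 'k pt = "monom \<Rightarrow> nat \<Rightarrow> 'k"

definition Mk :: "nat list \<Rightarrow> 'k::comm_ring_1 pt" where
  "Mk a m j = ratk (coeff (Mrat a m) j)"

definition pt_lincomb :: "(nat list \<Rightarrow> 'k::comm_ring_1) \<Rightarrow> nat list set \<Rightarrow> 'k pt" where
  "pt_lincomb c S = (\<lambda>m j. \<Sum>a\<in>S. c a * Mk a m j)"

definition RenQSym :: "'k::comm_ring_1 pt set" where
  "RenQSym = {pt_lincomb c S | c S. finite S}"

definition pt_mult :: "'k::comm_ring_1 pt \<Rightarrow> 'k pt \<Rightarrow> 'k pt" where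
  "pt_mult f g m j = (\<Sum>p\<in>{(m1, m2). m1 + m2 = m}. \<Sum>q\<in>{(j1, j2). j1 + j2 = j}.
       f (fst p) (fst q) * g (snd p) (snd q))"

definition pt_one :: "'k::comm_ring_1 pt" where
  "pt_one m j = (if m = 0 \<and> j = 0 then 1 else 0)"

fun qsh :: "nat list \<Rightarrow> nat list \<Rightarrow> nat list multiset" where
  "qsh [] b = {#b#}"
| "qsh a [] = {#a#}"
| "qsh (x # a) (y # b) = image_mset (Cons x) (qsh a (y # b))
     + image_mset (Cons y) (qsh (x # a) b) + image_mset (Cons (x + y)) (qsh a b)"

definition QS :: "(nat list \<Rightarrow> 'k::comm_ring_1) set" where
  "QS = {u. finite {a. u a \<noteq> 0}}"

definition qs_mult :: "(nat list \<Rightarrow> 'k::comm_ring_1) \<Rightarrow> (nat list \<Rightarrow> 'k) \<Rightarrow> nat list \<Rightarrow> 'k" where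
  "qs_mult u v w = (\<Sum>a\<in>{a. u a \<noteq> 0}. \<Sum>b\<in>{b. v b \<noteq> 0}.
       u a * v b * of_nat (count (qsh a b) w))"

definition qs_one :: "nat list \<Rightarrow> 'k::comm_ring_1" where
  "qs_one w = (if w = [] then 1 else 0)"

end

theory Submission
  imports Defs
begin

text \<open>
  Write a weak composition as \<open>\<alpha> 0\<^sup>s\<close> with \<open>\<alpha>\<close> left weak, and let \<open>n\<close> be the largest index of a
  variable in a monomial \<open>m\<close>. With all \<open>\<beta>\<close> equal to 1, the coefficient of \<open>m\<close> in \<open>\<phi>\<close> is a finite sum
  of exponentials times the coefficient of \<open>y\<^sup>s\<close> in \<open>\<Prod>\<^sub>j\<^sub>\<ge>\<^sub>1 (1 + y e\<^bsup>(u+j)z\<^esup>)\<close>, where \<open>u = t + n\<close>. The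
  logarithmic derivative of this product in \<open>y\<close> is the sum of a polar part that does not depend on
  \<open>u\<close> and a regular part with constant term \<open>(-u - 1/2) / (1 + y)\<close>. Exponentiating gives the Birkhoff
  decomposition, with the same counterterms for all \<open>m\<close>; the renormalized product is
  \<open>(1 + y)\<^bsup>-u-1/2\<^esup>\<close> at \<open>z = 0\<close>.

  Hence the coefficient of \<open>m\<close> in \<open>M\<^bsub>\<alpha> 0\<dots>0\<^esub>\<close> is the polynomial in \<open>N\<close> that counts the
  occurrences of \<open>m\<close> in the truncation to \<open>x\<^sub>1, \<dots>, x\<^sub>N\<close>, evaluated at \<open>N = -t - 1/2\<close>. The quasi-shuffle
  product formula and linear independence therefore follow from the case of finitely many variables.
\<close>

section \<open>Linear differential equations for power series\<close>

lemma fps_linear_ode_nth_Suc: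
  fixes F l :: "'a::field_char_0 fps"
  assumes "fps_deriv F = l * F"
  shows "fps_nth F (Suc n) = (\<Sum>i\<le>n. fps_nth l i * fps_nth F (n - i)) / of_nat (Suc n)"
proof -
  have "fps_nth (fps_deriv F) n = (\<Sum>i\<le>n. fps_nth l i * fps_nth F (n - i))"
    by (simp only: assms fps_mult_nth atMost_atLeast0)
  then show ?thesis
    by (simp add: nonzero_eq_divide_eq mult.commute del: of_nat_Suc)
qed

lemma fps_linear_ode_nth_Suc_in:
  fixes F l :: "'a::field_char_0 fps"
  assumes ode: "fps_deriv F = l * F" and F0: "fps_nth F 0 = 1"
    and zero: "0 \<in> S" and add: "\<And>x y. x \<in> S \<Longrightarrow> y \<in> S \<Longrightarrow> x + y \<in> S"
    and mult: "\<And>x y. x \<in> S \<Longrightarrow> y \<in> S \<Longrightarrow> x * y \<in> S"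
    and divide: "\<And>x k. x \<in> S \<Longrightarrow> x / of_nat k \<in> S"
    and l: "\<And>n. fps_nth l n \<in> S"
  shows "fps_nth F (Suc n) \<in> S"
proof (induction n rule: less_induct)
  case (less n)
  have summand: "fps_nth l i * fps_nth F (n - i) \<in> S" if "i \<le> n" for i
  proof (cases "n - i")
    case 0
    then show ?thesis using l by (simp add: F0)
  next
    case (Suc k)
    then show ?thesis using less[of k] that by (simp add: mult l)
  qed
  have sum: "sum f I \<in> S" if "\<And>i. i \<in> I \<Longrightarrow> f i \<in> S" for f :: "nat \<Rightarrow> 'a" and I
    using that by (induction I rule: infinite_finite_induct) (simp_all add: zero add)
  show ?case
    unfolding fps_linear_ode_nth_Suc[OF ode] by (intro divide sum summand) simp
qed

section \<open>Euler's product over a geometric progression\<close>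

text \<open>Euler's formulas for the elementary symmetric functions and the power sums of the
  sequence \<open>c q, c q\<^sup>2, c q\<^sup>3, \<dots>\<close>; the first is the coefficient of \<open>y\<^sup>s\<close> in \<open>\<Prod>\<^sub>j\<^sub>\<ge>\<^sub>1 (1 + c q\<^sup>j y)\<close>.\<close>

definition geom_esym :: "'a::field \<Rightarrow> 'a \<Rightarrow> nat \<Rightarrow> 'a" where
  "geom_esym q c s = c ^ s * (\<Prod>l=1..s. q ^ l / (1 - q ^ l))"

definition geom_psum :: "'a::field \<Rightarrow> 'a \<Rightarrow> nat \<Rightarrow> 'a" where
  "geom_psum q c n = (c * q) ^ n / (1 - q ^ n)"

definition geom_esym_gf :: "'a::field \<Rightarrow> 'a \<Rightarrow> 'a fps" where
  "geom_esym_gf q c = Abs_fps (geom_esym q c)"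

definition geom_psum_gf :: "'a::field \<Rightarrow> 'a \<Rightarrow> 'a fps" where
  "geom_psum_gf q c = Abs_fps (\<lambda>n. (- 1) ^ n * geom_psum q c (Suc n))"

lemma geom_esym_0 [simp]: "geom_esym q c 0 = 1"
  by (simp add: geom_esym_def)

lemma geom_esym_mult_q: "geom_esym q (c * q) s = q ^ s * geom_esym q c s"
  by (simp add: geom_esym_def power_mult_distrib)

lemma geom_esym_Suc:
  assumes "q ^ Suc s \<noteq> 1"
  shows "geom_esym q c (Suc s) = geom_esym q (c * q) (Suc s) + c * q * geom_esym q (c * q) s"
proof -
  have "(1 - q ^ Suc s) * geom_esym q c (Suc s) = c * q * geom_esym q (c * q) s"
    using assms by (simp add: geom_esym_def power_mult_distrib)
  then show ?thesis
    by (simp add: geom_esym_mult_q algebra_simps)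
qed

lemma geom_esym_gf_mult_q:
  "geom_esym_gf q (c * q) = geom_esym_gf q c oo (fps_const q * fps_X)"
  by (simp add: fps_eq_iff geom_esym_gf_def geom_esym_mult_q)

lemma geom_psum_gf_mult_q:
  "geom_psum_gf q (c * q) = fps_const q * (geom_psum_gf q c oo (fps_const q * fps_X))"
  unfolding fps_eq_iff fps_mult_left_const_nth fps_nth_compose_linear
  by (simp add: geom_psum_gf_def geom_psum_def power_mult_distrib mult_ac)

lemma geom_esym_gf_rec:
  assumes "\<And>n. n > 0 \<Longrightarrow> q ^ n \<noteq> 1"
  shows "geom_esym_gf q c = (1 + fps_const (c * q) * fps_X) * geom_esym_gf q (c * q)"
proof (rule fps_ext)
  fix n
  have "q ^ Suc m \<noteq> 1" for m
    by (rule assms) simp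
  then show "fps_nth (geom_esym_gf q c) n
      = fps_nth ((1 + fps_const (c * q) * fps_X) * geom_esym_gf q (c * q)) n"
    by (cases n) (simp_all add: geom_esym_gf_def geom_esym_Suc[of q _ c] distrib_right mult.assoc)
qed

lemma geom_psum_gf_rec:
  assumes "\<And>n. n > 0 \<Longrightarrow> q ^ n \<noteq> 1"
  shows "(1 + fps_const (c * q) * fps_X) * geom_psum_gf q c
    = (1 + fps_const (c * q) * fps_X) * geom_psum_gf q (c * q) + fps_const (c * q)"
proof -
  have psum: "geom_psum q c (Suc n) - geom_psum q (c * q) (Suc n) = (c * q) ^ Suc n" for n
  proof -
    have "1 - q ^ Suc n \<noteq> 0"
      using assms[of "Suc n"] by simp
    moreover have "geom_psum q c (Suc n) - geom_psum q (c * q) (Suc n)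
        = (c * q) ^ Suc n * (1 - q ^ Suc n) / (1 - q ^ Suc n)"
      by (simp add: geom_psum_def power_mult_distrib right_diff_distrib mult_ac
          flip: diff_divide_distrib)
    ultimately show ?thesis
      by (metis nonzero_mult_div_cancel_right)
  qed
  have diff: "geom_psum_gf q c - geom_psum_gf q (c * q) = Abs_fps (\<lambda>n. (- 1) ^ n * (c * q) ^ Suc n)"
    by (simp add: fps_eq_iff geom_psum_gf_def psum flip: right_diff_distrib del: power_Suc)
  have "(1 + fps_const (c * q) * fps_X) * (geom_psum_gf q c - geom_psum_gf q (c * q))
      = fps_const (c * q)"
  proof (rule fps_ext)
    fix n
    show "fps_nth ((1 + fps_const (c * q) * fps_X) * (geom_psum_gf q c - geom_psum_gf q (c * q))) n
        = fps_nth (fps_const (c * q)) n"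
      unfolding diff by (cases n) (simp_all add: distrib_right mult.assoc)
  qed
  then show ?thesis
    by (simp add: algebra_simps)
qed

lemma q_difference_eq_0:
  fixes V :: "'a::idom fps"
  assumes V: "V = (1 + fps_const d * fps_X) * (fps_const q * (V oo (fps_const q * fps_X)))"
    and q: "\<And>n. n > 0 \<Longrightarrow> q ^ n \<noteq> 1"
  shows "V = 0"
proof -
  have rec: "fps_nth V n = q ^ Suc n * fps_nth V n
      + (if n = 0 then 0 else d * (q ^ n * fps_nth V (n - 1)))" for n
    by (subst (1) V, cases n) (simp_all add: distrib_right mult.assoc)
  have "fps_nth V n = 0" for n
  proof (induction n)
    case 0
    have "(1 - q ^ 1) * fps_nth V 0 = 0"
      using rec[of 0] by (simp add: left_diff_distrib)
    then show ?case
      using q[of 1] by simp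
  next
    case (Suc n)
    then have "(1 - q ^ Suc (Suc n)) * fps_nth V (Suc n) = 0"
      using rec[of "Suc n"] by (simp add: left_diff_distrib)
    moreover have "q ^ Suc (Suc n) \<noteq> 1"
      by (rule q) simp
    ultimately show ?case
      by (simp del: power_Suc)
  qed
  then show ?thesis
    by (simp add: fps_eq_iff)
qed

text \<open>Newton's identities. The defect \<open>V c\<close> of the differential equation satisfies the same
  \<open>q\<close>-difference equation as the product, up to a factor \<open>q\<close> that forces it to vanish.\<close>
lemma fps_deriv_geom_esym_gf:
  assumes q: "\<And>n. n > 0 \<Longrightarrow> q ^ n \<noteq> (1 :: 'a::field)"
  shows "fps_deriv (geom_esym_gf q c) = geom_psum_gf q c * geom_esym_gf q c"
proof -
  define V where "V c = fps_deriv (geom_esym_gf q c) - geom_psum_gf q c * geom_esym_gf q c" for c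
  let ?u = "1 + fps_const (c * q) * fps_X :: 'a fps" and ?s = "fps_const q * fps_X :: 'a fps"
  let ?E = "geom_esym_gf q" and ?P = "geom_psum_gf q"
  have "fps_deriv (?E c) = fps_const (c * q) * ?E (c * q) + ?u * fps_deriv (?E (c * q))"
    by (subst geom_esym_gf_rec[OF q]) simp_all
  moreover have "?P c * ?E c = (?u * ?P (c * q) + fps_const (c * q)) * ?E (c * q)"
  proof -
    have "?P c * ?E c = ?u * ?P c * ?E (c * q)"
      by (subst geom_esym_gf_rec[OF q]) (simp_all only: mult_ac)
    then show ?thesis
      by (simp only: geom_psum_gf_rec[OF q])
  qed
  ultimately have "V c = ?u * V (c * q)"
    by (simp add: V_def algebra_simps)
  also have "V (c * q) = fps_const q * (V c oo ?s)"
  proof -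
    have "fps_deriv (?E (c * q)) = fps_const q * (fps_deriv (?E c) oo ?s)"
      by (simp add: geom_esym_gf_mult_q fps_compose_deriv mult.commute)
    moreover have "?P (c * q) * ?E (c * q) = fps_const q * (?P c * ?E c oo ?s)"
      by (simp add: geom_esym_gf_mult_q geom_psum_gf_mult_q fps_compose_mult_distrib mult.assoc)
    ultimately show ?thesis
      by (simp add: V_def fps_compose_sub_distrib right_diff_distrib)
  qed
  finally have "V c = 0"
    by (rule q_difference_eq_0) (rule q)
  then show ?thesis
    by (simp add: V_def)
qed

section \<open>Regular and purely polar Laurent series\<close>

lemma fls_prpart_mult_eq_0:
  fixes F G :: "'a::comm_semiring_1 fls"
  shows "fls_prpart F = 0 \<Longrightarrow> fls_prpart G = 0 \<Longrightarrow> fls_prpart (F * G) = 0"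
  by (simp add: fls_prpart_eq0_iff fls_mult_subdegree_ge_0)

lemma fls_prpart_sum_eq_0: "(\<And>i. i \<in> I \<Longrightarrow> fls_prpart (f i) = 0) \<Longrightarrow> fls_prpart (sum f I) = 0"
  by (induction I rule: infinite_finite_induct) simp_all

lemma fls_nth_0_mult:
  fixes F G :: "'a::comm_semiring_1 fls"
  assumes "fls_prpart F = 0" "fls_prpart G = 0"
  shows "fls_nth (F * G) 0 = fls_nth F 0 * fls_nth G 0"
proof -
  have "F * G = fps_to_fls (fls_regpart F * fls_regpart G)"
    using assms by (simp add: fls_prpart_eq0_iff fls_times_fps_to_fls)
  then show ?thesis
    by simp
qed

lemma fls_regpart_eq_0_iff: "fls_regpart F = 0 \<longleftrightarrow> (\<forall>n\<ge>0. fls_nth F n = 0)"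
  by (metis fls_regpart_nth fps_eq_iff fps_zero_nth nat_0_le of_nat_0_le_iff)

lemma fls_regpart_mult_eq_0:
  fixes F G :: "'a::comm_semiring_1 fls"
  assumes "fls_regpart F = 0" "fls_regpart G = 0"
  shows "fls_regpart (F * G) = 0"
  unfolding fls_regpart_eq_0_iff
proof (intro allI impI)
  fix n :: int
  assume "0 \<le> n"
  then have "fls_nth F i * fls_nth G (n - i) = 0" for i
    using assms by (cases "0 \<le> i") (auto simp: fls_regpart_eq_0_iff)
  then show "fls_nth (F * G) n = 0"
    unfolding fls_times_nth(2) by simp
qed

lemma fls_divide_of_nat: "F / of_nat k = fls_const (1 / of_nat k) * (F :: 'a::field fls)"
proof (cases "of_nat k = (0 :: 'a)")
  case False
  then show ?thesis
    by (simp add: fls_of_nat nonzero_divide_eq_eq mult.assoc mult.commute[of F] fls_const_mult_const)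
qed (simp add: fls_of_nat)

lemma fls_nth_minus_one_power_mult:
  "fls_nth ((- 1) ^ n * F) k = (- 1) ^ n * fls_nth (F :: 'a::comm_ring_1 fls) k"
  by (cases "even n") simp_all

definition exp_fls :: "'a::field_char_0 \<Rightarrow> 'a fls" where
  "exp_fls c = fps_to_fls (fps_exp c)"

lemma exp_fls_0 [simp]: "exp_fls 0 = 1"
  by (simp add: exp_fls_def)

lemma exp_fls_add: "exp_fls (a + b) = exp_fls a * exp_fls b"
  by (simp add: exp_fls_def fps_exp_add_mult fls_times_fps_to_fls)

lemma exp_fls_power: "exp_fls c ^ n = exp_fls (of_nat n * c)"
  by (induction n) (simp_all add: exp_fls_add algebra_simps)

lemma exp_fls_neq_1: "c \<noteq> 0 \<Longrightarrow> exp_fls c \<noteq> 1"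
  by (auto simp: exp_fls_def fps_eq_iff intro!: exI[of _ 1])

lemma exp_fls_1_power_neq_1: "n > 0 \<Longrightarrow> exp_fls 1 ^ n \<noteq> (1 :: 'a::field_char_0 fls)"
  using exp_fls_neq_1[of "of_nat n :: 'a"] by (simp add: exp_fls_power)

lemma fls_prpart_exp_fls [simp]: "fls_prpart (exp_fls c) = 0"
  by (simp add: exp_fls_def fls_prpart_eq0_iff fls_subdegree_fls_to_fps)

lemma fls_nth_exp_fls_0 [simp]: "fls_nth (exp_fls c) 0 = 1"
  by (simp add: exp_fls_def)

section \<open>Birkhoff decomposition of the Euler product\<close>

text \<open>\<open>z e\<^bsup>Naz\<^esup> / (e\<^bsup>Nz\<^esup> - 1)\<close>, up to scaling the generating function of the Bernoulli
  polynomials in \<open>a\<close>.\<close>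
definition bernoulli_gf :: "'a::field_char_0 \<Rightarrow> 'a \<Rightarrow> 'a fps" where
  "bernoulli_gf N a = fps_exp (N * a) / fps_shift 1 (fps_exp N - 1)"

lemma bernoulli_gf_mult:
  assumes "N \<noteq> 0"
  shows "bernoulli_gf N a * fps_shift 1 (fps_exp N - 1) = fps_exp (N * a)"
  using assms by (simp add: bernoulli_gf_def fps_divide_unit inverse_mult_eq_1 mult.assoc)

lemma bernoulli_gf_nth:
  assumes "N \<noteq> 0"
  shows "fps_nth (bernoulli_gf N a) 0 = 1 / N" and "fps_nth (bernoulli_gf N a) 1 = a - 1 / 2"
proof -
  let ?h = "bernoulli_gf N a" and ?v = "fps_shift 1 (fps_exp N - 1)"
  have v: "fps_nth ?v 0 = N" "fps_nth ?v (Suc 0) = N ^ 2 / 2"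
    by (simp_all add: fact_2 numeral_2_eq_2 fps_exp_def)
  have "fps_nth ?h 0 * N = 1"
    using arg_cong[OF bernoulli_gf_mult[OF assms, of a], of "\<lambda>F. fps_nth F 0"] by (simp add: v(1))
  then show h0: "fps_nth ?h 0 = 1 / N"
    using assms by (simp add: nonzero_eq_divide_eq)
  have "fps_nth ?h 0 * (N ^ 2 / 2) + fps_nth ?h 1 * N = N * a"
    using arg_cong[OF bernoulli_gf_mult[OF assms, of a], of "\<lambda>F. fps_nth F 1"]
    by (simp add: fps_mult_nth v[simplified])
  then have "N * fps_nth ?h 1 = N * (a - 1 / 2)"
    using assms unfolding h0 by (simp add: field_simps power2_eq_square)
  then show "fps_nth ?h 1 = a - 1 / 2"
    using assms by simp
qed

lemma exp_fls_divide_one_minus_exp_fls: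
  assumes "N \<noteq> 0"
  shows "exp_fls (N * a) / (1 - exp_fls N) = - fls_shift 1 (fps_to_fls (bernoulli_gf N a))"
proof -
  let ?v = "fps_shift 1 (fps_exp N - 1)"
  have "fps_X * ?v = fps_exp N - 1"
    by (rule fps_ext) auto
  then have "fls_X * fps_to_fls ?v = exp_fls N - 1"
    by (simp add: exp_fls_def flip: fps_X_to_fls fls_times_fps_to_fls)
  then have "1 - exp_fls N = - (fls_X * fps_to_fls ?v)"
    by simp
  moreover have "exp_fls (N * a) = fps_to_fls (bernoulli_gf N a) * fps_to_fls ?v"
    using assms by (simp add: exp_fls_def flip: fls_times_fps_to_fls bernoulli_gf_mult)
  moreover have "fps_to_fls ?v \<noteq> 0"
    using assms by (auto simp: fps_eq_iff intro!: exI[of _ 0])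
  ultimately show ?thesis
    by simp
qed

text \<open>With \<open>q = e\<^sup>z\<close> and \<open>c = e\<^sup>u\<^sup>z\<close> the power sums are
  \<open>e\<^bsup>n(u+1)z\<^esup> / (1 - e\<^bsup>nz\<^esup>) = -1/(n z) - (u + 1/2) + \<dots>\<close>: the polar part does not depend on \<open>u\<close>,
  the constant term does not depend on \<open>n\<close>.\<close>
lemma geom_psum_exp_fls:
  fixes u :: "'a::field_char_0"
  assumes "n > 0"
  defines "F \<equiv> geom_psum (exp_fls 1) (exp_fls u) n + fls_const (1 / of_nat n) * fls_X_inv"
  shows "fls_prpart F = 0" and "fls_nth F 0 = - u - 1 / 2"
proof -
  let ?N = "of_nat n :: 'a"
  have N: "?N \<noteq> 0"
    using assms by simp
  have F: "F = fls_const (1 / ?N) * fls_X_inv - fls_shift 1 (fps_to_fls (bernoulli_gf ?N (u + 1)))"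
    using exp_fls_divide_one_minus_exp_fls[OF N, of "u + 1"]
    by (simp add: F_def geom_psum_def exp_fls_power flip: exp_fls_add)
  show "fls_prpart F = 0"
    unfolding fls_prpart_eq0_iff
  proof (rule fls_subdegree_ge0I)
    fix k :: int
    assume "k < 0"
    then show "fls_nth F k = 0"
      by (cases "k = - 1") (simp_all add: F bernoulli_gf_nth(1)[OF N])
  qed
  show "fls_nth F 0 = - u - 1 / 2"
    using bernoulli_gf_nth(2)[OF N, of "u + 1"] by (simp add: F)
qed

definition pole_gf :: "'a::field_char_0 fls fps" where
  "pole_gf = Abs_fps (\<lambda>n. (- 1) ^ n * (fls_const (1 / of_nat (Suc n)) * fls_X_inv))"

definition counterterm_gf :: "'a::field_char_0 fls fps" where
  "counterterm_gf = fps_exp 1 oo fps_integral0 pole_gf"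

lemma counterterm_gf_nth_0 [simp]: "fps_nth counterterm_gf 0 = 1"
  by (simp add: counterterm_gf_def)

lemma fps_deriv_counterterm_gf: "fps_deriv counterterm_gf = pole_gf * counterterm_gf"
proof -
  have "fps_nth (fps_integral0 pole_gf) 0 = 0"
    by (simp add: fps_integral_def)
  then show ?thesis
    by (simp add: counterterm_gf_def fps_compose_deriv fps_deriv_fps_integral mult.commute)
qed

lemma fls_regpart_counterterm_gf:
  assumes "n > 0"
  shows "fls_regpart (fps_nth counterterm_gf n) = 0"
proof -
  have pole: "fls_regpart (fps_nth pole_gf n) = 0" for n
    by (simp add: fls_regpart_eq_0_iff pole_gf_def fls_nth_minus_one_power_mult)
  have divide: "fls_regpart (F / of_nat k) = 0" if "fls_regpart F = 0" for F :: "'a fls" and k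
    using that by (simp add: fls_regpart_eq_0_iff fls_divide_of_nat)
  obtain k where "n = Suc k"
    using assms gr0_conv_Suc by auto
  moreover have "fps_nth counterterm_gf (Suc k) \<in> {F :: 'a fls. fls_regpart F = 0}"
    by (rule fps_linear_ode_nth_Suc_in[OF fps_deriv_counterterm_gf])
      (simp_all add: pole fls_regpart_mult_eq_0 divide)
  ultimately show ?thesis
    by simp
qed

definition const_term_gf :: "'a::zero fls fps \<Rightarrow> 'a fps" where
  "const_term_gf F = Abs_fps (\<lambda>n. fls_nth (fps_nth F n) 0)"

lemma fps_deriv_const_term_gf: "fps_deriv (const_term_gf F) = const_term_gf (fps_deriv F)"
  by (simp add: fps_eq_iff const_term_gf_def fls_of_nat del: of_nat_Suc)

lemma const_term_gf_mult:
  fixes F G :: "'a::comm_semiring_1 fls fps"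
  assumes "\<And>n. fls_prpart (fps_nth F n) = 0" "\<And>n. fls_prpart (fps_nth G n) = 0"
  shows "const_term_gf (F * G) = const_term_gf F * const_term_gf G"
  by (simp add: fps_eq_iff const_term_gf_def fps_mult_nth fls_nth_sum fls_nth_0_mult assms)

definition renormalized_gf :: "'a::field_char_0 \<Rightarrow> 'a fls fps" where
  "renormalized_gf u = geom_esym_gf (exp_fls 1) (exp_fls u) * counterterm_gf"

lemma renormalized_gf_nth_0 [simp]: "fps_nth (renormalized_gf u) 0 = 1"
  by (simp add: renormalized_gf_def geom_esym_gf_def)

definition subtracted_psum_gf :: "'a::field_char_0 \<Rightarrow> 'a fls fps" where
  "subtracted_psum_gf u = geom_psum_gf (exp_fls 1) (exp_fls u) + pole_gf"

lemma fps_deriv_renormalized_gf: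
  "fps_deriv (renormalized_gf u) = subtracted_psum_gf u * renormalized_gf u"
  by (simp add: renormalized_gf_def subtracted_psum_gf_def algebra_simps
      fps_deriv_geom_esym_gf[OF exp_fls_1_power_neq_1] fps_deriv_counterterm_gf)

lemma fps_nth_subtracted_psum_gf:
  "fps_nth (subtracted_psum_gf u) n = (- 1) ^ n *
    (geom_psum (exp_fls 1) (exp_fls u) (Suc n) + fls_const (1 / of_nat (Suc n)) * fls_X_inv)"
  by (simp add: subtracted_psum_gf_def geom_psum_gf_def pole_gf_def distrib_left del: of_nat_Suc)

lemma fls_prpart_subtracted_psum_gf: "fls_prpart (fps_nth (subtracted_psum_gf u) n) = 0"
proof -
  have "fls_prpart ((- 1) ^ n :: 'a fls) = 0"
    by (cases "even n") simp_all
  then show ?thesis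
    unfolding fps_nth_subtracted_psum_gf
    by (intro fls_prpart_mult_eq_0 geom_psum_exp_fls(1) zero_less_Suc)
qed

lemma const_term_gf_subtracted_psum_gf:
  fixes u :: "'a::field_char_0"
  shows "const_term_gf (subtracted_psum_gf u) = fps_const (- u - 1 / 2) / (1 + fps_X)"
proof -
  let ?B = "const_term_gf (subtracted_psum_gf u)"
  have nth: "fps_nth ?B n = (- 1) ^ n * (- u - 1 / 2)" for n
    unfolding const_term_gf_def fps_nth_Abs_fps fps_nth_subtracted_psum_gf
      fls_nth_minus_one_power_mult
    by (simp only: geom_psum_exp_fls(2)[OF zero_less_Suc])
  have "?B * (1 + fps_X) = fps_const (- u - 1 / 2)"
  proof (rule fps_ext)
    fix n
    show "fps_nth (?B * (1 + fps_X)) n = fps_nth (fps_const (- u - 1 / 2)) n"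
      by (cases n) (simp_all add: nth distrib_left)
  qed
  moreover have "1 + fps_X \<noteq> (0 :: 'a fps)"
    by (rule fps_nonzeroI[of _ 0]) simp
  ultimately show ?thesis
    by (metis nonzero_mult_div_cancel_right)
qed

lemma fls_prpart_renormalized_gf: "fls_prpart (fps_nth (renormalized_gf u) n) = 0"
proof (cases n)
  case (Suc k)
  have "fps_nth (renormalized_gf u) (Suc k) \<in> {F. fls_prpart F = 0}"
    by (rule fps_linear_ode_nth_Suc_in[OF fps_deriv_renormalized_gf])
      (simp_all add: fls_prpart_subtracted_psum_gf fls_prpart_mult_eq_0 fls_divide_of_nat)
  then show ?thesis
    by (simp add: Suc)
qed simp

lemma fls_nth_renormalized_gf_0:
  "fls_nth (fps_nth (renormalized_gf u) n) 0 = (- u - 1 / 2) gchoose n"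
proof -
  let ?B = "const_term_gf (renormalized_gf u)" and ?v = "- u - 1 / 2"
  have "fps_deriv ?B = fps_const ?v / (1 + fps_X) * ?B"
    unfolding fps_deriv_const_term_gf fps_deriv_renormalized_gf
    by (simp add: const_term_gf_mult fls_prpart_subtracted_psum_gf fls_prpart_renormalized_gf
        const_term_gf_subtracted_psum_gf)
  then have "fps_deriv ?B = fps_const ?v * ?B / (1 + fps_X)"
    by (simp add: fps_divide_unit mult_ac)
  moreover have "fps_nth ?B 0 = 1"
    by (simp add: const_term_gf_def)
  ultimately have "?B = fps_binomial ?v"
    by (subst fps_binomial_ODE_unique'[symmetric]) simp
  then have "fps_nth ?B n = ?v gchoose n"
    by simp
  then show ?thesis
    by (simp add: const_term_gf_def)
qed

section \<open>Increasing lists\<close>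

definition incr_lists :: "'a::linorder set \<Rightarrow> nat \<Rightarrow> 'a list set" where
  "incr_lists A k = {j. length j = k \<and> sorted_wrt (<) j \<and> set j \<subseteq> A}"

lemma incr_lists_0 [simp]: "incr_lists A 0 = {[]}"
  by (auto simp: incr_lists_def)

lemma finite_incr_lists [simp]: "finite A \<Longrightarrow> finite (incr_lists A k)"
  by (rule finite_subset[OF _ finite_lists_length_eq[of A k]]) (auto simp: incr_lists_def)

lemma bij_betw_set_incr_lists:
  assumes "finite A"
  shows "bij_betw set (incr_lists A k) {B. B \<subseteq> A \<and> card B = k}"
proof (rule bij_betwI[where g = sorted_list_of_set])
  have fin: "finite B" if "B \<subseteq> A" for B
    using that assms by (rule finite_subset)
  show "set \<in> incr_lists A k \<rightarrow> {B. B \<subseteq> A \<and> card B = k}"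
    by (auto simp: incr_lists_def strict_sorted_iff distinct_card)
  show "sorted_list_of_set \<in> {B. B \<subseteq> A \<and> card B = k} \<rightarrow> incr_lists A k"
    by (auto simp: incr_lists_def fin)
  show "sorted_list_of_set (set j) = j" if "j \<in> incr_lists A k" for j
    using that
    by (simp add: incr_lists_def strict_sorted_iff sorted_list_of_set.idem_if_sorted_distinct)
  show "set (sorted_list_of_set B) = B" if "B \<in> {B. B \<subseteq> A \<and> card B = k}" for B
    using that by (simp add: fin)
qed

lemma card_incr_lists: "finite A \<Longrightarrow> card (incr_lists A k) = card A choose k"
  by (simp add: bij_betw_same_card[OF bij_betw_set_incr_lists] n_subsets)

lemma bij_betw_Cons_incr_lists:
  "bij_betw (\<lambda>(x, j). x # j) (SIGMA x:{n<..}. incr_lists {x<..} k) (incr_lists {n<..} (Suc k))"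
proof (rule bij_betw_imageI)
  show "(\<lambda>(x, j). x # j) ` (SIGMA x:{n<..}. incr_lists {x<..} k) = incr_lists {n<..} (Suc k)"
    by (force simp: incr_lists_def length_Suc_conv image_iff)
qed (auto simp: inj_on_def)

lemma incr_lists_insert_min:
  assumes "\<forall>x\<in>A. p < x"
  shows "incr_lists (insert p A) (Suc k) = incr_lists A (Suc k) \<union> Cons p ` incr_lists A k"
proof (intro equalityI subsetI)
  fix i
  assume "i \<in> incr_lists (insert p A) (Suc k)"
  then obtain x j where i: "i = x # j" "length j = k" "sorted_wrt (<) j" "\<forall>y\<in>set j. x < y"
    "x \<in> insert p A" "set j \<subseteq> insert p A"
    by (auto simp: incr_lists_def length_Suc_conv)
  then have "p \<notin> set j"
    using assms by fastforce
  then show "i \<in> incr_lists A (Suc k) \<union> Cons p ` incr_lists A k"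
    using i by (cases "x = p") (auto simp: incr_lists_def)
qed (use assms in \<open>fastforce simp: incr_lists_def\<close>)

section \<open>Monomials and left weak compositions\<close>

lemma mono_of_Nil [simp]: "mono_of [] [] = 0"
  by (simp add: mono_of_def)

lemma mono_of_Cons [simp]: "mono_of (x # i) (y # a) = Poly_Mapping.single x y + mono_of i a"
  unfolding mono_of_def by (simp add: sum.lessThan_Suc_shift del: sum.lessThan_Suc)

lemma mono_of_append:
  "length i = length a \<Longrightarrow> mono_of (i @ j) (a @ b) = mono_of i a + mono_of j b"
  by (induction i a rule: list_induct2) (simp_all add: add.assoc)

lemma mono_of_replicate_0: "length i = s \<Longrightarrow> mono_of i (replicate s 0) = 0"
  by (induction i arbitrary: s) auto

lemma keys_mono_of: "length i = length a \<Longrightarrow> Poly_Mapping.keys (mono_of i a) \<subseteq> set i"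
proof (induction i a rule: list_induct2)
  case (Cons x i y a)
  then show ?case
    using Poly_Mapping.keys_add[of "Poly_Mapping.single x y" "mono_of i a"]
    by (auto split: if_splits)
qed simp

lemma mono_of_inject:
  assumes "length a = length i" "length b = length i" "distinct i" "mono_of i a = mono_of i b"
  shows "a = b"
  using assms
proof (induction i arbitrary: a b)
  case (Cons x i)
  obtain y a' z b' where ab: "a = y # a'" "b = z # b'"
    using Cons.prems by (cases a; cases b) auto
  have "x \<notin> Poly_Mapping.keys (mono_of i c)" if "length i = length c" for c
    using keys_mono_of[OF that] Cons.prems by auto
  then have "Poly_Mapping.lookup (mono_of i a') x = 0" "Poly_Mapping.lookup (mono_of i b') x = 0"
    using Cons.prems ab by (simp_all add: in_keys_iff)
  then have "y = z"
    using arg_cong[OF Cons.prems(4), of "\<lambda>m. Poly_Mapping.lookup m x"] by (simp add: ab lookup_add)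
  then show ?case
    using Cons by (simp add: ab)
qed simp

definition top_var :: "monom \<Rightarrow> nat" where
  "top_var m = Max (insert 0 (Poly_Mapping.keys m))"

lemma top_var_0 [simp]: "top_var 0 = 0"
  by (simp add: top_var_def)

lemma top_var_le_iff: "top_var m \<le> N \<longleftrightarrow> (\<forall>x\<in>Poly_Mapping.keys m. x \<le> N)"
  by (simp add: top_var_def)

lemma top_var_add: "top_var (m1 + m2) = max (top_var m1) (top_var m2)" for m1 m2 :: monom
proof -
  have "Poly_Mapping.keys (m1 + m2) = Poly_Mapping.keys m1 \<union> Poly_Mapping.keys m2"
    by (auto simp: in_keys_iff lookup_add)
  then have "top_var (m1 + m2)
      = Max (insert 0 (Poly_Mapping.keys m1) \<union> insert 0 (Poly_Mapping.keys m2))"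
    by (simp add: top_var_def)
  then show ?thesis
    by (simp add: top_var_def Max_Un del: Un_insert_left Un_insert_right)
qed

definition left_weak :: "nat list \<Rightarrow> bool" where
  "left_weak a \<longleftrightarrow> a = [] \<or> last a \<noteq> 0"

lemma left_weak_Nil [simp]: "left_weak []"
  by (simp add: left_weak_def)

lemma trailing_zeros_decomp:
  obtains a' s where "a = a' @ replicate s 0" "left_weak a'"
proof (induction a arbitrary: thesis rule: rev_induct)
  case Nil
  then show ?case
    using left_weak_Nil by (metis append_Nil replicate_0)
next
  case (snoc x a)
  show ?case
  proof (cases "x = 0")
    case True
    obtain a' s where "a = a' @ replicate s 0" "left_weak a'"
      using snoc.IH by blast
    then show ?thesis
      using True by (intro snoc.prems[of a' "Suc s"]) (auto simp: replicate_append_same)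
  next
    case False
    then show ?thesis
      by (intro snoc.prems[of "a @ [x]" 0]) (auto simp: left_weak_def)
  qed
qed

lemma top_var_mono_of:
  assumes len: "length i = length a" and sorted: "sorted_wrt (<) i" and a: "left_weak a"
  shows "top_var (mono_of i a) = Max (insert 0 (set i))"
proof (cases "i = []")
  case False
  then obtain i' x a' y where i: "i = i' @ [x]" and a': "a = a' @ [y]"
    using len by (metis length_0_conv rev_exhaust)
  have "mono_of i a = mono_of i' a' + Poly_Mapping.single x y"
    using len by (simp add: i a' mono_of_append)
  then have "x \<in> Poly_Mapping.keys (mono_of i a)"
    using a by (simp add: a' left_weak_def in_keys_iff lookup_add)
  moreover have le: "z \<le> x" if "z \<in> insert 0 (set i)" for z
    using that sorted by (auto simp: i sorted_wrt_append)
  ultimately have "top_var (mono_of i a) = x"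
    unfolding top_var_def using keys_mono_of[OF len] by (intro Max_eqI) auto
  also have "x = Max (insert 0 (set i))"
    using le by (intro Max_eqI[symmetric]) (simp_all add: i)
  finally show ?thesis .
qed (use len in simp)

section \<open>Occurrences of a monomial\<close>

definition index_lists :: "nat set \<Rightarrow> nat list \<Rightarrow> monom \<Rightarrow> nat list set" where
  "index_lists A a m = {i \<in> incr_lists A (length a). mono_of i a = m}"

lemma idx_set_eq_index_lists: "idx_set a m = index_lists {0<..} a m"
  by (auto simp: idx_set_def index_lists_def incr_lists_def)

lemma idx_set_Nil: "idx_set [] m = (if m = 0 then {[]} else {})"
  by (auto simp: idx_set_def)

lemma index_lists_top_var:
  assumes "left_weak a" "i \<in> index_lists A a m"
  shows "top_var m = Max (insert 0 (set i))"
  using assms top_var_mono_of by (auto simp: index_lists_def incr_lists_def)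

lemma index_lists_restrict:
  assumes "left_weak a" "top_var m \<le> N"
  shows "index_lists (A \<inter> {..N}) a m = index_lists A a m"
proof -
  have "set i \<subseteq> {..N}" if "i \<in> index_lists A a m" for i
    using index_lists_top_var[OF assms(1) that] assms(2) by auto
  then show ?thesis
    by (auto simp: index_lists_def incr_lists_def)
qed

lemma finite_idx_set:
  assumes "left_weak a"
  shows "finite (idx_set a m)"
proof -
  have "index_lists ({0<..} \<inter> {..top_var m}) a m \<subseteq> incr_lists ({0<..} \<inter> {..top_var m}) (length a)"
    by (auto simp: index_lists_def)
  then show ?thesis
    unfolding idx_set_eq_index_lists
    by (subst index_lists_restrict[OF assms order.refl, symmetric]) (rule finite_subset, auto)
qed

lemma index_lists_append_zeros:
  assumes a: "left_weak a" and A: "A \<subseteq> {0<..}"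
  shows "index_lists A (a @ replicate s 0) m
    = (\<Union>i\<in>index_lists A a m. (@) i ` incr_lists (A \<inter> {top_var m<..}) s)"
proof (intro equalityI subsetI)
  fix k
  assume k: "k \<in> index_lists A (a @ replicate s 0) m"
  define i j where "i = take (length a) k" and "j = drop (length a) k"
  have kij: "k = i @ j" and len: "length i = length a" "length j = s"
    using k by (auto simp: i_def j_def index_lists_def incr_lists_def)
  have i: "i \<in> index_lists A a m"
    using k len unfolding kij
    by (auto simp: index_lists_def incr_lists_def mono_of_append mono_of_replicate_0 sorted_wrt_append)
  moreover have "j \<in> incr_lists (A \<inter> {top_var m<..}) s"
    using k len A unfolding kij index_lists_top_var[OF a i]
    by (auto simp: index_lists_def incr_lists_def sorted_wrt_append)
  ultimately show "k \<in> (\<Union>i\<in>index_lists A a m. (@) i ` incr_lists (A \<inter> {top_var m<..}) s)"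
    using kij by auto
next
  fix k
  assume "k \<in> (\<Union>i\<in>index_lists A a m. (@) i ` incr_lists (A \<inter> {top_var m<..}) s)"
  then obtain i j where kij: "k = i @ j" and i: "i \<in> index_lists A a m"
    and j: "j \<in> incr_lists (A \<inter> {top_var m<..}) s"
    by auto
  have "x < y" if "x \<in> set i" "y \<in> set j" for x y
    using j that unfolding index_lists_top_var[OF a i] by (auto simp: incr_lists_def)
  then show "k \<in> index_lists A (a @ replicate s 0) m"
    using i j unfolding kij
    by (auto simp: index_lists_def incr_lists_def mono_of_append mono_of_replicate_0 sorted_wrt_append)
qed

lemma append_image_disjoint:
  "i \<in> index_lists A a m \<Longrightarrow> i' \<in> index_lists A a m \<Longrightarrow> i \<noteq> i' \<Longrightarrow> (@) i ` J \<inter> (@) i' ` J = {}"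
  by (auto simp: index_lists_def incr_lists_def)

section \<open>The regularized sums\<close>

lemma has_sum_geometric_greaterThan:
  fixes c :: "'a::{real_normed_field, banach}"
  assumes "norm c < 1"
  shows "((\<lambda>j. c ^ j) has_sum (c ^ Suc n / (1 - c))) {n<..}"
proof -
  have "((\<lambda>j. c ^ j) has_sum (1 / (1 - c))) UNIV"
    by (rule norm_summable_imp_has_sum)
       (use assms in \<open>auto simp: norm_power intro: geometric_sums summable_geometric\<close>)
  then have "((\<lambda>j. c ^ Suc n * c ^ j) has_sum (c ^ Suc n * (1 / (1 - c)))) UNIV"
    by (rule has_sum_cmult_right)
  then have "((\<lambda>j. c ^ (Suc n + j)) has_sum (c ^ Suc n / (1 - c))) UNIV"
    by (simp only: power_add times_divide_eq_right mult_1_right)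
  moreover have "bij_betw (\<lambda>j. Suc n + j) UNIV {n<..}"
    by (rule bij_betwI[of _ _ _ "\<lambda>j. j - Suc n"]) auto
  ultimately show ?thesis
    by (subst (asm) has_sum_reindex_bij_betw)
qed

lemma has_sum_geom_esym_Suc:
  fixes q :: "'a::{real_normed_field, banach}"
  assumes q: "norm q < 1"
    and IH: "\<And>n. ((\<lambda>j. q ^ sum_list j) has_sum geom_esym q (q ^ n) s) (incr_lists {n<..} s)"
    and summable: "(\<lambda>x. q ^ x * geom_esym q (q ^ x) s) summable_on {n<..} \<Longrightarrow>
      (\<lambda>(x, j). q ^ x * q ^ sum_list j) summable_on (SIGMA x:{n<..}. incr_lists {x<..} s)"
  shows "((\<lambda>j. q ^ sum_list j) has_sum geom_esym q (q ^ n) (Suc s)) (incr_lists {n<..} (Suc s))"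
proof -
  let ?K = "\<Prod>l=1..s. q ^ l / (1 - q ^ l)"
  have pow: "(q ^ s) ^ k = (q ^ k) ^ s" for k
    by (metis mult.commute power_mult)
  have "norm (q ^ Suc s) < 1"
    unfolding norm_power using q by (simp add: power_less_one_iff del: power_Suc)
  from has_sum_cmult_left[OF has_sum_geometric_greaterThan[OF this, of n], of ?K]
  have "((\<lambda>x. (q ^ Suc s) ^ x * ?K) has_sum ((q ^ Suc s) ^ Suc n / (1 - q ^ Suc s) * ?K)) {n<..}" .
  also have "(\<lambda>x. (q ^ Suc s) ^ x * ?K) = (\<lambda>x. q ^ x * geom_esym q (q ^ x) s)"
    by (simp add: geom_esym_def power_mult_distrib pow mult.assoc fun_eq_iff)
  also have "(q ^ Suc s) ^ Suc n / (1 - q ^ Suc s) * ?K = geom_esym q (q ^ n) (Suc s)"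
    by (simp add: geom_esym_def power_mult_distrib pow mult_ac)
  finally have outer:
    "((\<lambda>x. q ^ x * geom_esym q (q ^ x) s) has_sum geom_esym q (q ^ n) (Suc s)) {n<..}" .
  have "((\<lambda>(x, j). q ^ x * q ^ sum_list j) has_sum geom_esym q (q ^ n) (Suc s))
      (SIGMA x:{n<..}. incr_lists {x<..} s)"
    by (rule has_sum_SigmaI[OF _ outer summable[OF has_sum_imp_summable[OF outer]]])
       (simp add: has_sum_cmult_right[OF IH])
  then show ?thesis
    by (subst has_sum_reindex_bij_betw[OF bij_betw_Cons_incr_lists, symmetric])
       (simp add: case_prod_unfold power_add)
qed

lemma has_sum_geom_esym_real:
  fixes r :: real
  assumes "0 \<le> r" "r < 1"
  shows "((\<lambda>j. r ^ sum_list j) has_sum geom_esym r (r ^ n) s) (incr_lists {n<..} s)"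
proof (induction s arbitrary: n)
  case 0
  show ?case
    by (rule has_sum_finiteI) auto
next
  case (Suc s)
  show ?case
  proof (rule has_sum_geom_esym_Suc)
    assume "(\<lambda>x. r ^ x * geom_esym r (r ^ x) s) summable_on {n<..}"
    then show "(\<lambda>(x, j). r ^ x * r ^ sum_list j) summable_on (SIGMA x:{n<..}. incr_lists {x<..} s)"
      by (rule summable_on_SigmaI[rotated]) (use assms Suc in \<open>auto intro: has_sum_cmult_right\<close>)
  qed (use assms Suc in auto)
qed

lemma has_sum_geom_esym:
  fixes q :: "'a::{real_normed_field, banach}"
  assumes "norm q < 1"
  shows "((\<lambda>j. q ^ sum_list j) has_sum geom_esym q (q ^ n) s) (incr_lists {n<..} s)"
proof (induction s arbitrary: n)
  case 0
  show ?case
    by (rule has_sum_finiteI) auto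
next
  case (Suc s)
  show ?case
  proof (rule has_sum_geom_esym_Suc)
    have "(\<lambda>j. norm q ^ sum_list j) summable_on incr_lists {n<..} (Suc s)"
      using has_sum_geom_esym_real[of "norm q" n "Suc s"] assms by (auto intro: has_sum_imp_summable)
    then have "(\<lambda>j. q ^ sum_list j) summable_on incr_lists {n<..} (Suc s)"
      by (simp add: abs_summable_summable norm_power)
    then show "(\<lambda>(x, j). q ^ x * q ^ sum_list j) summable_on (SIGMA x:{n<..}. incr_lists {x<..} s)"
      by (subst (asm) summable_on_reindex_bij_betw[OF bij_betw_Cons_incr_lists, symmetric])
         (simp add: case_prod_unfold power_add)
  qed (use assms Suc in auto)
qed

definition unit_cols :: "nat list \<Rightarrow> (nat \<times> nat) list" where
  "unit_cols a = map (\<lambda>x. (x, 1)) a"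

lemma unit_cols_simps [simp]:
  "length (unit_cols a) = length a" "map fst (unit_cols a) = a"
  "unit_cols [] = []" "unit_cols a = [] \<longleftrightarrow> a = []"
  "take n (unit_cols a) = unit_cols (take n a)" "drop n (unit_cols a) = unit_cols (drop n a)"
  by (simp_all add: unit_cols_def comp_def take_map drop_map)

definition exponent :: "real \<Rightarrow> nat list \<Rightarrow> complex" where
  "exponent t i = of_nat (sum_list i) + of_nat (length i) * of_real t"

lemma exponent_append: "exponent t (i @ j) = exponent t i + exponent t j"
  by (simp add: exponent_def algebra_simps)

lemma phi_fun_unit_cols:
  "phi_fun t (unit_cols a) m z = infsum (\<lambda>i. exp (exponent t i * z)) (idx_set a m)"
  unfolding phi_fun_def unit_cols_simps
proof (rule infsum_cong)
  fix i
  assume "i \<in> idx_set a m"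
  then have len: "length i = length a"
    by (simp add: idx_set_def)
  have "(\<Sum>l<length a. (of_nat (i ! l) + complex_of_real t) * of_nat (snd (unit_cols a ! l)) * z)
      = (\<Sum>l<length i. (of_nat (i ! l) + complex_of_real t) * z)"
    by (intro sum.cong) (auto simp: unit_cols_def len)
  also have "\<dots> = exponent t i * z"
    by (simp add: exponent_def sum.distrib sum_list_sum_nth atLeast0LessThan flip: sum_distrib_right)
  finally show "exp (\<Sum>l<length a.
      (of_nat (i ! l) + complex_of_real t) * of_nat (snd (unit_cols a ! l)) * z) = exp (exponent t i * z)"
    by (rule arg_cong)
qed

lemma has_sum_exp_exponent:
  assumes "Re z < 0"
  shows "((\<lambda>j. exp (exponent t j * z)) has_sum geom_esym (exp z) (exp ((of_real t + of_nat n) * z)) s)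
    (incr_lists {n<..} s)"
proof -
  let ?d = "exp (complex_of_real t * z)"
  have "((\<lambda>j. exp z ^ sum_list j) has_sum geom_esym (exp z) (exp z ^ n) s) (incr_lists {n<..} s)"
    using assms by (intro has_sum_geom_esym) simp
  then have "((\<lambda>j. ?d ^ s * exp z ^ sum_list j) has_sum ?d ^ s * geom_esym (exp z) (exp z ^ n) s)
      (incr_lists {n<..} s)"
    by (rule has_sum_cmult_right)
  also have "((\<lambda>j. ?d ^ s * exp z ^ sum_list j) has_sum ?d ^ s * geom_esym (exp z) (exp z ^ n) s)
      (incr_lists {n<..} s) \<longleftrightarrow>
    ((\<lambda>j. exp (exponent t j * z)) has_sum ?d ^ s * geom_esym (exp z) (exp z ^ n) s) (incr_lists {n<..} s)"
    by (rule has_sum_cong)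
      (auto simp: incr_lists_def exponent_def distrib_right exp_add exp_of_nat_mult mult.assoc)
  also have "?d ^ s * geom_esym (exp z) (exp z ^ n) s
      = geom_esym (exp z) (exp ((of_real t + of_nat n) * z)) s"
    by (simp add: geom_esym_def exp_add distrib_right exp_of_nat_mult power_mult_distrib)
  finally show ?thesis .
qed

lemma phi_fun_append_zeros:
  assumes a: "left_weak a" and z: "Re z < 0"
  shows "phi_fun t (unit_cols (a @ replicate s 0)) m z = (\<Sum>i\<in>idx_set a m. exp (exponent t i * z))
    * geom_esym (exp z) (exp ((of_real t + of_nat (top_var m)) * z)) s"
proof -
  let ?J = "incr_lists {top_var m<..} s"
  let ?E = "geom_esym (exp z) (exp ((complex_of_real t + of_nat (top_var m)) * z)) s"
  have idx: "idx_set (a @ replicate s 0) m = (\<Union>i\<in>idx_set a m. (@) i ` ?J)"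
    unfolding idx_set_eq_index_lists index_lists_append_zeros[OF a order.refl]
    by (simp add: Int_absorb1 greaterThan_subset_iff)
  have "((\<lambda>k. exp (exponent t k * z)) has_sum (\<Sum>i\<in>idx_set a m. exp (exponent t i * z) * ?E))
      (\<Union>i\<in>idx_set a m. (@) i ` ?J)"
  proof (rule sum_has_sum)
    show "finite (idx_set a m)"
      by (rule finite_idx_set[OF a])
    show "(@) i ` ?J \<inter> (@) i' ` ?J = {}" if "i \<in> idx_set a m" "i' \<in> idx_set a m" "i \<noteq> i'" for i i'
      using that unfolding idx_set_eq_index_lists by (rule append_image_disjoint)
    show "((\<lambda>k. exp (exponent t k * z)) has_sum (exp (exponent t i * z) * ?E)) ((@) i ` ?J)" for i
    proof (subst has_sum_reindex)
      show "((\<lambda>k. exp (exponent t k * z)) \<circ> (@) i has_sum exp (exponent t i * z) * ?E) ?J"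
        using has_sum_cmult_right[OF has_sum_exp_exponent[OF z], of "exp (exponent t i * z)"]
        by (simp add: comp_def exponent_append distrib_right exp_add)
    qed (simp add: inj_on_def)
  qed
  then show ?thesis
    unfolding phi_fun_unit_cols idx by (simp add: infsumI sum_distrib_right)
qed

lemma has_laurent_expansion_exp_mult:
  fixes c :: complex
  shows "(\<lambda>z. exp (c * z)) has_laurent_expansion exp_fls c"
  unfolding exp_fls_def by (intro has_laurent_expansion_fps has_fps_expansion_exp)

lemma has_laurent_expansion_geom_esym:
  "(\<lambda>z. geom_esym (exp z) (exp (u * z)) s) has_laurent_expansion geom_esym (exp_fls 1) (exp_fls u) s"
  unfolding geom_esym_def
  by (intro laurent_expansion_intros has_laurent_expansion_exp_mult
      has_laurent_expansion_exp_mult[of 1, simplified])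

lemma phi_eqI:
  assumes f: "f has_laurent_expansion F" and eq: "\<And>z. Re z < 0 \<Longrightarrow> phi_fun t ab m z = f z"
  shows "phi t ab m = F"
  unfolding phi_def
proof (rule the_equality)
  have F: "0 < fls_conv_radius F" "\<forall>\<^sub>F z in at 0. eval_fls F z = f z"
    using f by (auto simp: has_laurent_expansion_def)
  show "0 < fls_conv_radius F \<and> (\<forall>\<^sub>F z in at 0. Re z < 0 \<longrightarrow> eval_fls F z = phi_fun t ab m z)"
    using F(1) eventually_mono[OF F(2)] by (simp add: eq)
next
  fix G
  assume G: "0 < fls_conv_radius G \<and> (\<forall>\<^sub>F z in at 0. Re z < 0 \<longrightarrow> eval_fls G z = phi_fun t ab m z)"
  have "(\<lambda>z. eval_fls G z - f z) has_laurent_expansion G - F"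
    using G f by (intro has_laurent_expansion_diff) (auto simp: has_laurent_expansion_def)
  then have "(\<exists>\<^sub>F z in at 0. eval_fls G z - f z = 0) \<longleftrightarrow> G - F = 0"
    using has_laurent_expansion_frequently_zero_iff[of "\<lambda>z. eval_fls G z - f z" 0] by simp
  moreover have "\<exists>\<^sub>F z in at (0::complex). Re z < 0"
    unfolding frequently_at
  proof (intro allI impI)
    fix e :: real
    assume "e > 0"
    then show "\<exists>z\<in>UNIV. z \<noteq> 0 \<and> dist z (0::complex) < e \<and> Re z < 0"
      by (intro bexI[of _ "of_real (- e / 2)"]) auto
  qed
  moreover have "\<forall>\<^sub>F z in at 0. Re z < 0 \<longrightarrow> eval_fls G z - f z = 0"
    using G by (auto elim!: eventually_mono simp: eq)
  ultimately show "G = F"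
    using frequently_rev_mp by force
qed

definition exp_sum_fls :: "real \<Rightarrow> nat list \<Rightarrow> monom \<Rightarrow> complex fls" where
  "exp_sum_fls t a m = (\<Sum>i\<in>idx_set a m. exp_fls (exponent t i))"

lemma exp_sum_fls_Nil: "exp_sum_fls t [] m = (if m = 0 then 1 else 0)"
  by (simp add: exp_sum_fls_def idx_set_Nil exponent_def)

lemma fls_prpart_exp_sum_fls [simp]: "fls_prpart (exp_sum_fls t a m) = 0"
  unfolding exp_sum_fls_def by (intro fls_prpart_sum_eq_0 fls_prpart_exp_fls)

lemma fls_nth_exp_sum_fls_0: "fls_nth (exp_sum_fls t a m) 0 = of_nat (card (idx_set a m))"
  by (simp add: exp_sum_fls_def fls_nth_sum)

lemma phi_append_zeros:
  assumes "left_weak a"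
  shows "phi t (unit_cols (a @ replicate s 0)) m
    = exp_sum_fls t a m * geom_esym (exp_fls 1) (exp_fls (of_real t + of_nat (top_var m))) s"
  unfolding exp_sum_fls_def
  by (rule phi_eqI[OF _ phi_fun_append_zeros[OF assms]])
    (intro laurent_expansion_intros has_laurent_expansion_exp_mult has_laurent_expansion_geom_esym)

section \<open>The renormalized values\<close>

lemma finite_poly_mapping_splits: "finite {(m1, m2). m1 + m2 = (m :: 'a \<Rightarrow>\<^sub>0 nat)}"
proof (rule finite_subset)
  let ?L = "{m' :: 'a \<Rightarrow>\<^sub>0 nat. \<forall>x. Poly_Mapping.lookup m' x \<le> Poly_Mapping.lookup m x}"
  let ?K = "Poly_Mapping.keys m"
  let ?F = "{f. \<forall>x. (x \<in> ?K \<longrightarrow> f x \<in> (\<Union>y\<in>?K. {..Poly_Mapping.lookup m y})) \<and> (x \<notin> ?K \<longrightarrow> f x = 0)}"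
  show "{(m1, m2). m1 + m2 = m} \<subseteq> ?L \<times> ?L"
    by (auto simp: lookup_add)
  have "Poly_Mapping.lookup ` ?L \<subseteq> ?F"
    by (auto simp: in_keys_iff) (metis le_zero_eq)+
  moreover have "finite ?F"
    by (rule finite_set_of_finite_funs) auto
  ultimately have "finite ?L"
    by (rule finite_imageD[OF finite_subset]) (simp add: inj_on_def poly_mapping_eqI)
  then show "finite (?L \<times> ?L)"
    by simp
qed

definition counterterm :: "nat list \<Rightarrow> nat \<Rightarrow> ser" where
  "counterterm a s m = (if a = [] \<and> m = 0 then fps_nth counterterm_gf s else 0)"

lemma ser_mult_counterterm:
  "ser_mult f (counterterm a s) m = f m * (if a = [] then fps_nth counterterm_gf s else 0)"
proof -
  have "ser_mult f (counterterm a s) m = (\<Sum>p\<in>{(m, 0)}. f (fst p) * counterterm a s (snd p))"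
    unfolding ser_mult_def
    by (rule sum.mono_neutral_right) (auto simp: finite_poly_mapping_splits counterterm_def)
  then show ?thesis
    by (simp add: counterterm_def)
qed

lemma fls_regpart_counterterm:
  assumes "0 < length a + s"
  shows "fls_regpart (counterterm a s m) = 0"
  using assms by (simp add: counterterm_def fls_regpart_counterterm_gf)

definition renormalized :: "real \<Rightarrow> nat list \<Rightarrow> nat \<Rightarrow> ser" where
  "renormalized t a s m
    = exp_sum_fls t a m * fps_nth (renormalized_gf (of_real t + of_nat (top_var m))) s"

lemma fls_prpart_renormalized: "fls_prpart (renormalized t a s m) = 0"
  by (simp add: renormalized_def fls_prpart_mult_eq_0 fls_prpart_renormalized_gf)

lemma fls_nth_renormalized_0:
  "fls_nth (renormalized t a s m) 0
    = of_nat (card (idx_set a m)) * ((- of_real t - 1 / 2 - of_nat (top_var m)) gchoose s)"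
proof -
  have "- (complex_of_real t + of_nat (top_var m)) - 1 / 2 = - of_real t - 1 / 2 - of_nat (top_var m)"
    by simp
  then show ?thesis
    by (simp only: renormalized_def fls_nth_0_mult fls_prpart_exp_sum_fls fls_prpart_renormalized_gf
        fls_nth_renormalized_gf_0 fls_nth_exp_sum_fls_0)
qed

lemma polar_regular_minus_polar:
  assumes "f m = R - N" "fls_prpart R = 0" "fls_regpart N = 0"
  shows "polar f m = - N"
  using assms by (simp add: polar_def fls_prpart_eq0_iff)

declare phi_minus.simps [simp del]

lemma phi_minus_Nil: "phi_minus t [] = ser_one"
  by (simp add: phi_minus.simps)

lemma phi_minus_eq_polar_renE: "ab \<noteq> [] \<Longrightarrow> phi_minus t ab = (\<lambda>m. - polar (renE t ab) m)"
  by (subst phi_minus.simps) (simp add: polar_def renE_def)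

lemma renE_eq_sum:
  "renE t ab m = phi t ab m
    + (\<Sum>i\<in>{1..<length ab}. ser_mult (phi t (take i ab)) (phi_minus t (drop i ab)) m)"
  by (simp add: renE_def interv_sum_list_conv_sum_set_nat)

lemma Zval_eq_renE: "Zval t ab m = fls_nth (renE t ab m) 0"
  by (simp add: Zval_def phi_plus_def polar_def)

lemma ser_mult_phi_phi_minus:
  assumes a: "left_weak a" and i: "1 \<le> i" "i < length a + s"
    and IH: "\<And>b r. left_weak b \<Longrightarrow> length b + r < length a + s \<Longrightarrow>
      phi_minus t (unit_cols (b @ replicate r 0)) = counterterm b r"
  shows "ser_mult (phi t (unit_cols (take i (a @ replicate s 0))))
      (phi_minus t (unit_cols (drop i (a @ replicate s 0)))) m
    = exp_sum_fls t a m * (if i < length a then 0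
      else geom_esym (exp_fls 1) (exp_fls (of_real t + of_nat (top_var m))) (i - length a)
        * fps_nth counterterm_gf (length a + s - i))"
proof (cases "i < length a")
  case True
  have "phi_minus t (unit_cols (drop i a @ replicate s 0)) = counterterm (drop i a) s"
    using a i True by (intro IH) (auto simp: left_weak_def)
  then show ?thesis
    using True by (simp add: ser_mult_counterterm)
next
  case False
  have "phi_minus t (unit_cols ([] @ replicate (length a + s - i) 0)) = counterterm [] (length a + s - i)"
    using i by (intro IH) auto
  moreover have "take i (a @ replicate s 0) = a @ replicate (i - length a) 0"
    "drop i (a @ replicate s 0) = [] @ replicate (length a + s - i) 0"
    using i False by (auto simp: min_def)
  ultimately show ?thesis
    using False phi_append_zeros[OF a] by (simp only: ser_mult_counterterm) simp
qed

text \<open>The recursion for \<open>E\<close> is the convolution of the Euler product with the counterterms. Its missing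
  term, at the empty prefix, is nonzero only if \<open>\<alpha>\<close> consists of zeros.\<close>
lemma renE_append_zeros:
  assumes a: "left_weak a" and ne: "0 < length a + s"
    and IH: "\<And>b r. left_weak b \<Longrightarrow> length b + r < length a + s \<Longrightarrow>
      phi_minus t (unit_cols (b @ replicate r 0)) = counterterm b r"
  shows "renE t (unit_cols (a @ replicate s 0)) m = renormalized t a s m - counterterm a s m"
proof -
  let ?k = "length a"
  define e :: "nat \<Rightarrow> complex fls"
    where "e = geom_esym (exp_fls 1) (exp_fls (of_real t + of_nat (top_var m)))"
  define g where
    "g i = (if i < ?k then 0 else e (i - ?k) * fps_nth counterterm_gf (?k + s - i))" for i
  have "ser_mult (phi t (unit_cols (take i (a @ replicate s 0))))
      (phi_minus t (unit_cols (drop i (a @ replicate s 0)))) m = exp_sum_fls t a m * g i"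
    if "i \<in> {1..<?k + s}" for i
    unfolding g_def e_def by (rule ser_mult_phi_phi_minus[OF a _ _ IH]) (use that in auto)
  then have "renE t (unit_cols (a @ replicate s 0)) m
      = exp_sum_fls t a m * (g (?k + s) + (\<Sum>i\<in>{1..<?k + s}. g i))"
    by (simp add: renE_eq_sum phi_append_zeros[OF a] g_def[of "?k + s"] e_def distrib_left
        sum_distrib_left del: take_append drop_append)
  also have "g (?k + s) + (\<Sum>i\<in>{1..<?k + s}. g i) = (\<Sum>i\<in>{0..?k + s}. g i) - g 0"
  proof -
    have "{0..?k + s} = insert 0 (insert (?k + s) {1..<?k + s})"
      using ne by auto
    then show ?thesis
      using ne by simp
  qed
  also have "(\<Sum>i\<in>{0..?k + s}. g i) = (\<Sum>i\<in>{0 + ?k..s + ?k}. g i)"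
    by (rule sum.mono_neutral_right) (auto simp: g_def)
  also have "\<dots> = fps_nth (renormalized_gf (of_real t + of_nat (top_var m))) s"
    unfolding sum.shift_bounds_cl_nat_ivl
    by (simp add: renormalized_gf_def geom_esym_gf_def fps_mult_nth g_def e_def)
  also have "g 0 = (if a = [] then fps_nth counterterm_gf s else 0)"
    by (simp add: g_def e_def)
  finally show ?thesis
    by (auto simp: renormalized_def counterterm_def exp_sum_fls_Nil right_diff_distrib)
qed

lemma phi_minus_append_zeros:
  assumes "left_weak a"
  shows "phi_minus t (unit_cols (a @ replicate s 0)) = counterterm a s"
  using assms
proof (induction "length a + s" arbitrary: a s rule: less_induct)
  case less
  let ?ab = "unit_cols (a @ replicate s 0)"
  show ?case
  proof (cases "length a + s = 0")
    case True
    then show ?thesis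
      by (simp add: phi_minus_Nil ser_one_def counterterm_def fun_eq_iff)
  next
    case False
    have polar: "polar (renE t ?ab) m = - counterterm a s m" for m
    proof (rule polar_regular_minus_polar)
      show "renE t ?ab m = renormalized t a s m - counterterm a s m"
        by (rule renE_append_zeros) (use less False in auto)
      show "fls_prpart (renormalized t a s m) = 0"
        by (rule fls_prpart_renormalized)
      show "fls_regpart (counterterm a s m) = 0"
        using False by (intro fls_regpart_counterterm) simp
    qed
    have "?ab \<noteq> []"
      using False by auto
    then show ?thesis
      by (subst phi_minus_eq_polar_renE) (assumption, simp only: polar minus_minus)
  qed
qed

lemma Zval_append_zeros:
  assumes a: "left_weak a"
  shows "Zval t (unit_cols (a @ replicate s 0)) m
    = of_nat (card (idx_set a m)) * ((- of_real t - 1 / 2 - of_nat (top_var m)) gchoose s)"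
proof (cases "length a + s = 0")
  case True
  then show ?thesis
    using phi_append_zeros[of "[]" t 0 m]
    by (simp add: Zval_eq_renE renE_def exp_sum_fls_Nil idx_set_Nil)
next
  case False
  have "renE t (unit_cols (a @ replicate s 0)) m = renormalized t a s m - counterterm a s m"
    by (rule renE_append_zeros[OF a _ phi_minus_append_zeros]) (use False in auto)
  moreover have "fls_nth (counterterm a s m) 0 = 0"
    using fls_regpart_counterterm[of a s m] False by (simp add: fls_regpart_eq_0_iff)
  ultimately show ?thesis
    by (simp add: Zval_eq_renE fls_nth_renormalized_0)
qed

section \<open>The coefficient polynomials\<close>

locale ring_morphism = additive h for h :: "'a::comm_ring_1 \<Rightarrow> 'b::comm_ring_1" +
  assumes one: "h 1 = 1" and mult: "h (x * y) = h x * h y"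
begin

lemma map_poly_mult: "map_poly h (p * q) = map_poly h p * map_poly h q"
  by (rule poly_eqI) (simp add: coeff_map_poly zero coeff_mult sum mult)

lemma map_poly_sum: "map_poly h (\<Sum>i\<in>I. f i) = (\<Sum>i\<in>I. map_poly h (f i))"
  by (rule poly_eqI) (simp add: coeff_map_poly zero coeff_sum sum)

lemma map_poly_smult: "map_poly h (smult c p) = smult (h c) (map_poly h p)"
  by (rule poly_eqI) (simp add: coeff_map_poly zero mult)

lemma map_poly_prod: "map_poly h (\<Prod>i\<in>I. f i) = (\<Prod>i\<in>I. map_poly h (f i))"
  by (induction I rule: infinite_finite_induct) (simp_all add: map_poly_mult map_poly_1' one)

lemma poly_map_poly: "poly (map_poly h p) (h x) = h (poly p x)"
  by (induction p) (simp_all add: map_poly_pCons zero add mult)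

end

interpretation of_rat: ring_morphism "of_rat :: rat \<Rightarrow> 'a::field_char_0"
  by unfold_locales (simp_all add: of_rat_add of_rat_mult)

lemma poly_eqI_infinite:
  fixes p q :: "'a::{comm_ring_1, ring_no_zero_divisors} poly"
  assumes "infinite A" "\<And>x. x \<in> A \<Longrightarrow> poly p x = poly q x"
  shows "p = q"
proof (rule ccontr)
  assume "p \<noteq> q"
  then have "finite {x. poly (p - q) x = 0}"
    by (intro poly_roots_finite) simp
  moreover have "A \<subseteq> {x. poly (p - q) x = 0}"
    using assms(2) by auto
  ultimately show False
    using assms(1) finite_subset by blast
qed

definition gchoose_poly :: "nat \<Rightarrow> nat \<Rightarrow> 'a::field_char_0 poly" where
  "gchoose_poly n s = smult (1 / fact s) (\<Prod>i=0..<s. [:- 1 / 2 - of_nat n - of_nat i, - 1:])"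

lemma poly_gchoose_poly: "poly (gchoose_poly n s) x = (- x - 1 / 2 - of_nat n) gchoose s"
  by (simp add: gchoose_poly_def gbinomial_prod_rev poly_prod algebra_simps)

lemma map_poly_of_rat_gchoose_poly: "map_poly of_rat (gchoose_poly n s) = gchoose_poly n s"
proof -
  have "of_rat (fact s) = (fact s :: 'a)"
    by (metis of_nat_fact of_rat_of_nat_eq)
  then show ?thesis
    by (simp add: gchoose_poly_def of_rat.map_poly_smult of_rat.map_poly_prod map_poly_pCons
        of_rat_divide of_rat_diff of_rat_minus)
qed

lemma Mrat_append_zeros:
  assumes a: "left_weak a"
  shows "Mrat (a @ replicate s 0) m
    = smult (of_nat (card (idx_set a m))) (gchoose_poly (top_var m) s)" (is "_ = ?p")
  unfolding Mrat_def unit_cols_def[symmetric]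
proof (rule the_equality)
  let ?Z = "\<lambda>t. Zval t (unit_cols (a @ replicate s 0)) m"
  have p: "poly (map_poly of_rat ?p) (complex_of_real t) = ?Z t" for t
    by (simp add: Zval_append_zeros[OF a] of_rat.map_poly_smult map_poly_of_rat_gchoose_poly
        poly_gchoose_poly)
  then show "\<forall>t\<ge>0. poly (map_poly of_rat ?p) (complex_of_real t) = ?Z t"
    by blast
  fix p'
  assume p': "\<forall>t\<ge>0. poly (map_poly of_rat p') (complex_of_real t) = ?Z t"
  show "p' = ?p"
  proof (rule poly_eqI_infinite[of "\<nat>"])
    fix x :: rat
    assume "x \<in> \<nat>"
    then have "complex_of_real (of_rat x) = of_rat x" "0 \<le> (of_rat x :: real)"
      by (auto elim!: Nats_cases)
    then have "(of_rat (poly p' x) :: complex) = of_rat (poly ?p x)"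
      using p'[rule_format, of "of_rat x"] p[of "of_rat x"] by (simp add: of_rat.poly_map_poly)
    then show "poly p' x = poly ?p x"
      by simp
  qed (rule Nats_infinite)
qed

section \<open>Quasisymmetric polynomials in finitely many variables\<close>

lemma sum_mset_hom:
  assumes "h 0 = 0" "\<And>x y. h (x + y) = h x + h y"
  shows "h (\<Sum>c\<in>#A. f c) = (\<Sum>c\<in>#A. h (f c))"
  by (induction A) (simp_all add: assms)

definition qsym_poly :: "nat set \<Rightarrow> nat list \<Rightarrow> monom \<Rightarrow>\<^sub>0 'a::comm_semiring_1" where
  "qsym_poly A a = (\<Sum>i\<in>incr_lists A (length a). Poly_Mapping.single (mono_of i a) 1)"

lemma lookup_qsym_poly:
  assumes "finite A"
  shows "Poly_Mapping.lookup (qsym_poly A a) m = of_nat (card (index_lists A a m))"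
proof -
  have "Poly_Mapping.lookup (qsym_poly A a) m
      = (\<Sum>i\<in>incr_lists A (length a). if mono_of i a = m then 1 else 0)"
    by (simp add: qsym_poly_def Poly_Mapping.lookup_sum lookup_single when_def)
  also have "\<dots> = (\<Sum>i\<in>index_lists A a m. 1)"
    unfolding index_lists_def by (rule sum.inter_filter[symmetric]) (simp add: assms)
  finally show ?thesis
    by simp
qed

lemma qsym_poly_Nil: "qsym_poly A [] = 1"
  by (simp add: qsym_poly_def)

lemma qsym_poly_empty: "qsym_poly {} (x # a) = 0"
proof -
  have "incr_lists {} (Suc (length a)) = ({} :: nat list set)"
    by (auto simp: incr_lists_def)
  then show ?thesis
    by (simp add: qsym_poly_def)
qed

lemma qsym_poly_insert_min:
  assumes "finite A" "\<forall>x\<in>A. p < x"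
  shows "(qsym_poly (insert p A) (x # a) :: monom \<Rightarrow>\<^sub>0 'a::comm_semiring_1)
    = qsym_poly A (x # a) + Poly_Mapping.single (Poly_Mapping.single p x) 1 * qsym_poly A a"
proof -
  let ?M = "\<lambda>i. Poly_Mapping.single (mono_of i (x # a)) (1 :: 'a)"
  have "incr_lists A (Suc (length a)) \<inter> Cons p ` incr_lists A (length a) = {}"
    using assms by (auto simp: incr_lists_def)
  then have "qsym_poly (insert p A) (x # a)
      = qsym_poly A (x # a) + (\<Sum>i\<in>Cons p ` incr_lists A (length a). ?M i)"
    using assms by (simp add: qsym_poly_def incr_lists_insert_min sum.union_disjoint)
  also have "(\<Sum>i\<in>Cons p ` incr_lists A (length a). ?M i)
      = Poly_Mapping.single (Poly_Mapping.single p x) 1 * qsym_poly A a"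
    by (simp add: sum.reindex inj_on_def qsym_poly_def sum_distrib_left mult_single)
  finally show ?thesis .
qed

lemma qsym_poly_mult:
  assumes "finite A"
  shows "qsym_poly A a * qsym_poly A b
    = (\<Sum>c\<in>#qsh a b. qsym_poly A c :: monom \<Rightarrow>\<^sub>0 'a::comm_semiring_1)"
  using assms
proof (induction A arbitrary: a b rule: finite_linorder_min_induct)
  case empty
  show ?case
    by (cases "(a, b)" rule: qsh.cases)
      (simp_all add: qsym_poly_Nil qsym_poly_empty multiset.map_comp comp_def)
next
  case (insert p A)
  show ?case
  proof (cases "(a, b)" rule: qsh.cases)
    case (3 x a' y b')
    let ?X = "\<lambda>x. Poly_Mapping.single (Poly_Mapping.single p x) (1 :: 'a)"
    let ?F = "qsym_poly A :: nat list \<Rightarrow> monom \<Rightarrow>\<^sub>0 'a" and ?G = "qsym_poly (insert p A)"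
    note Cons = qsym_poly_insert_min[OF insert.hyps(1,2)]
    have X: "?X x * ?X y = ?X (x + y)"
      by (simp add: mult_single single_add)
    have "?G a * ?G b = (?F (x # a') + ?X x * ?F a') * (?F (y # b') + ?X y * ?F b')"
      using 3 by (simp add: Cons)
    also have "\<dots> = ?F (x # a') * ?F (y # b') + ?X x * (?F a' * ?F (y # b'))
        + ?X y * (?F (x # a') * ?F b') + ?X x * ?X y * (?F a' * ?F b')"
      by (simp add: algebra_simps)
    also have "\<dots> = (\<Sum>c\<in>#qsh (x # a') (y # b'). ?F c) + ?X x * (\<Sum>c\<in>#qsh a' (y # b'). ?F c)
        + ?X y * (\<Sum>c\<in>#qsh (x # a') b'. ?F c) + ?X (x + y) * (\<Sum>c\<in>#qsh a' b'. ?F c)"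
      unfolding insert.IH X ..
    also have "\<dots> = (\<Sum>c\<in>#qsh (x # a') (y # b'). ?G c)"
      by (simp add: multiset.map_comp comp_def Cons sum_mset.distrib
          sum_mset_distrib_left sum_mset_distrib_right algebra_simps)
    finally show ?thesis
      using 3 by simp
  qed (simp_all add: qsym_poly_Nil)
qed

text \<open>The coefficient polynomials interpolate the truncations to \<open>N\<close> variables:
  renormalization amounts to setting \<open>N = -t - 1/2\<close>.\<close>
lemma poly_Mrat:
  assumes "top_var m \<le> N"
  shows "poly (Mrat a m) (- 1 / 2 - of_nat N) = Poly_Mapping.lookup (qsym_poly {0<..N} a) m"
proof -
  obtain a' s where a: "a = a' @ replicate s 0" and a': "left_weak a'"
    by (rule trailing_zeros_decomp)
  let ?J = "incr_lists ({0<..N} \<inter> {top_var m<..}) s"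
  have "index_lists {0<..N} a' m = idx_set a' m"
    using index_lists_restrict[OF a' assms, of "{0<..}"]
    by (simp add: idx_set_eq_index_lists greaterThanAtMost_def)
  then have "index_lists {0<..N} a m = (\<Union>i\<in>idx_set a' m. (@) i ` ?J)"
    unfolding a by (subst index_lists_append_zeros[OF a']) auto
  also have "card \<dots> = (\<Sum>i\<in>idx_set a' m. card ((@) i ` ?J))"
    by (rule card_UN_disjoint)
      (use finite_idx_set[OF a'] append_image_disjoint in \<open>auto simp: idx_set_eq_index_lists\<close>)
  also have "{0<..N} \<inter> {top_var m<..} = {top_var m<..N}"
    by auto
  finally have "card (index_lists {0<..N} a m) = card (idx_set a' m) * (N - top_var m choose s)"
    by (simp add: card_image inj_on_def card_incr_lists)
  moreover have "poly (gchoose_poly (top_var m) s) (- 1 / 2 - of_nat N)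
      = (of_nat (N - top_var m) gchoose s :: rat)"
    using assms by (simp add: poly_gchoose_poly of_nat_diff)
  ultimately show ?thesis
    by (simp add: a Mrat_append_zeros[OF a'] lookup_qsym_poly binomial_gbinomial)
qed

lemma lookup_mult_splits:
  fixes f g :: "('a \<Rightarrow>\<^sub>0 nat) \<Rightarrow>\<^sub>0 'b::semiring_0"
  shows "Poly_Mapping.lookup (f * g) m =
    (\<Sum>p\<in>{(m1, m2). m1 + m2 = m}. Poly_Mapping.lookup f (fst p) * Poly_Mapping.lookup g (snd p))"
proof -
  have "Poly_Mapping.lookup (f * g) m
      = (\<Sum>(a, b). Poly_Mapping.lookup f a * Poly_Mapping.lookup g b when m = a + b)"
    unfolding times_poly_mapping.rep_eq by (rule prod_fun_unfold_prod) simp_all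
  also have "\<dots> = (\<Sum>(a, b)\<in>{(m1, m2). m1 + m2 = m}.
      Poly_Mapping.lookup f a * Poly_Mapping.lookup g b when m = a + b)"
    by (rule Sum_any.expand_superset) (auto simp: finite_poly_mapping_splits)
  also have "\<dots> = (\<Sum>p\<in>{(m1, m2). m1 + m2 = m}.
      Poly_Mapping.lookup f (fst p) * Poly_Mapping.lookup g (snd p))"
    by (intro sum.cong) auto
  finally show ?thesis .
qed

lemma Mrat_mult:
  "(\<Sum>p\<in>{(m1, m2). m1 + m2 = m}. Mrat a (fst p) * Mrat b (snd p)) = (\<Sum>c\<in>#qsh a b. Mrat c m)"
  (is "sum ?f ?S = ?R")
proof (rule poly_eqI_infinite)
  let ?x = "\<lambda>n. - 1 / 2 - of_nat (top_var m + n) :: rat"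
  show "infinite (range ?x)"
    by (rule range_inj_infinite) (simp add: inj_on_def)
  fix x
  assume "x \<in> range ?x"
  then obtain n where n: "x = ?x n"
    by (rule rangeE)
  define N where "N = top_var m + n"
  have N: "top_var m \<le> N" and x: "x = - 1 / 2 - of_nat N"
    by (simp_all add: N_def n)
  let ?M = "qsym_poly {0<..N} :: nat list \<Rightarrow> monom \<Rightarrow>\<^sub>0 rat"
  have f: "poly (?f p) x = Poly_Mapping.lookup (?M a) (fst p) * Poly_Mapping.lookup (?M b) (snd p)"
    if "p \<in> ?S" for p
  proof -
    have "top_var (fst p) \<le> N" "top_var (snd p) \<le> N"
      using that N top_var_add[of "fst p" "snd p"] by auto
    then show ?thesis
      by (simp only: poly_mult poly_Mrat x)
  qed
  have "poly (sum ?f ?S) x = Poly_Mapping.lookup (?M a * ?M b) m"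
    unfolding poly_sum lookup_mult_splits by (rule sum.cong[OF refl f])
  also have "\<dots> = Poly_Mapping.lookup (\<Sum>c\<in>#qsh a b. ?M c) m"
    by (simp only: qsym_poly_mult[OF finite_greaterThanAtMost])
  also have "\<dots> = (\<Sum>c\<in>#qsh a b. Poly_Mapping.lookup (?M c) m)"
    by (rule sum_mset_hom) (simp_all add: lookup_add)
  also have "\<dots> = (\<Sum>c\<in>#qsh a b. poly (Mrat c m) x)"
    by (simp only: poly_Mrat[OF N] x)
  also have "\<dots> = poly ?R x"
    by (rule sum_mset_hom[of "\<lambda>p. poly p x", symmetric]) simp_all
  finally show "poly (sum ?f ?S) x = poly ?R x" .
qed

lemma incr_lists_card:
  assumes "finite A"
  shows "incr_lists A (card A) = {sorted_list_of_set A}"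
proof -
  have "card (incr_lists A (card A)) = 1"
    by (simp add: card_incr_lists[OF assms])
  then obtain i where i: "incr_lists A (card A) = {i}"
    by (rule card_1_singletonE)
  moreover have "sorted_list_of_set A \<in> incr_lists A (card A)"
    using assms by (simp add: incr_lists_def)
  ultimately show ?thesis
    by simp
qed

lemma incr_lists_eq_empty:
  assumes "finite A" "card A < k"
  shows "incr_lists A k = {}"
proof -
  have "card (incr_lists A k) = 0"
    using assms(2) by (simp add: card_incr_lists[OF assms(1)] binomial_eq_0)
  then show ?thesis
    using finite_incr_lists[OF assms(1)] by (simp only: card_0_eq)
qed

definition leading_monom :: "nat list \<Rightarrow> monom" where
  "leading_monom a = mono_of (sorted_list_of_set {0<..length a}) a"

lemma top_var_leading_monom: "top_var (leading_monom a) \<le> length a"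
proof -
  have "Poly_Mapping.keys (leading_monom a) \<subseteq> {0<..length a}"
    unfolding leading_monom_def using keys_mono_of[of "sorted_list_of_set {0<..length a}" a] by simp
  then show ?thesis
    by (auto simp: top_var_le_iff)
qed

lemma lookup_qsym_poly_leading_monom:
  assumes "length a \<le> length b"
  shows "Poly_Mapping.lookup (qsym_poly {0<..length a} b) (leading_monom a)
    = (if a = b then 1 else 0)"
proof (cases "length a = length b")
  case True
  define i where "i = sorted_list_of_set {0<..length a}"
  have "incr_lists {0<..length a} (length b) = {i}"
    using incr_lists_card[of "{0<..length a}"] by (simp add: i_def True)
  moreover have "mono_of i b = leading_monom a \<longleftrightarrow> b = a"
  proof
    have "length a = length i" "length b = length i" "distinct i"
      by (simp_all add: i_def True)
    then show "b = a" if "mono_of i b = leading_monom a"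
      using that by (intro mono_of_inject[of b i a]) (simp_all add: leading_monom_def i_def)
  qed (simp add: leading_monom_def i_def)
  ultimately have "index_lists {0<..length a} b (leading_monom a) = (if a = b then {i} else {})"
    unfolding index_lists_def by auto
  then show ?thesis
    by (simp add: lookup_qsym_poly)
next
  case False
  then have "index_lists {0<..length a} b m = {}" for m
    using assms by (simp add: index_lists_def incr_lists_eq_empty)
  then show ?thesis
    using False by (auto simp: lookup_qsym_poly)
qed

lemma poly_Mrat_leading_monom:
  assumes "length a \<le> length b"
  shows "poly (Mrat b (leading_monom a)) (- 1 / 2 - of_nat (length a)) = (if a = b then 1 else 0)"
  by (simp only: poly_Mrat[OF top_var_leading_monom] lookup_qsym_poly_leading_monom[OF assms])

section \<open>Linear combinations over the scalar ring\<close>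

lemma pt_mult_coeff:
  "pt_mult (\<lambda>m. coeff (F m)) (\<lambda>m. coeff (G m)) m j
    = coeff (\<Sum>p\<in>{(m1, m2). m1 + m2 = m}. F (fst p) * G (snd p)) j"
proof -
  have "(\<Sum>q\<in>{(j1, j2). j1 + j2 = j}. coeff p (fst q) * coeff p' (snd q)) = coeff (p * p') j"
    for p p' :: "'a poly"
    unfolding coeff_mult by (rule sum.reindex_bij_witness[of _ "\<lambda>i. (i, j - i)" fst]) auto
  then show ?thesis
    by (simp add: pt_mult_def coeff_sum)
qed

lemma pt_mult_sum:
  "pt_mult (\<lambda>m j. \<Sum>a\<in>A. u a * F a m j) (\<lambda>m j. \<Sum>b\<in>B. v b * G b m j) m j
    = (\<Sum>a\<in>A. \<Sum>b\<in>B. u a * v b * pt_mult (F a) (G b) m j)"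
proof -
  let ?P = "{(m1, m2). m1 + m2 = m}" and ?Q = "{(j1, j2). j1 + j2 = j}"
  let ?h = "\<lambda>p q a b. u a * v b * (F a (fst p) (fst q) * G b (snd p) (snd q))"
  have "pt_mult (\<lambda>m j. \<Sum>a\<in>A. u a * F a m j) (\<lambda>m j. \<Sum>b\<in>B. v b * G b m j) m j
      = (\<Sum>p\<in>?P. \<Sum>q\<in>?Q. \<Sum>a\<in>A. \<Sum>b\<in>B. ?h p q a b)"
    by (simp add: pt_mult_def sum_product mult_ac)
  also have "\<dots> = (\<Sum>(p, q)\<in>?P \<times> ?Q. \<Sum>(a, b)\<in>A \<times> B. ?h p q a b)"
    by (simp flip: sum.cartesian_product)
  also have "\<dots> = (\<Sum>(a, b)\<in>A \<times> B. \<Sum>(p, q)\<in>?P \<times> ?Q. ?h p q a b)"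
    unfolding case_prod_unfold by (rule sum.swap)
  also have "\<dots> = (\<Sum>a\<in>A. \<Sum>b\<in>B. \<Sum>p\<in>?P. \<Sum>q\<in>?Q. ?h p q a b)"
    by (simp flip: sum.cartesian_product)
  finally show ?thesis
    by (simp add: pt_mult_def sum_distrib_left)
qed

lemma sum_count_mult:
  fixes f :: "'a \<Rightarrow> 'b::comm_semiring_1"
  assumes "finite W" "set_mset M \<subseteq> W"
  shows "(\<Sum>w\<in>W. of_nat (count M w) * f w) = (\<Sum>w\<in>#M. f w)"
  using assms(2)
proof (induction M)
  case (add x M)
  have "(\<Sum>w\<in>W. of_nat (count (add_mset x M) w) * f w)
      = (\<Sum>w\<in>W. (if w = x then f x else 0) + of_nat (count M w) * f w)"
    by (intro sum.cong) (auto simp: distrib_right)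
  also have "\<dots> = f x + (\<Sum>w\<in>W. of_nat (count M w) * f w)"
    using add.prems assms(1) by (simp add: sum.distrib)
  finally show ?case
    using add by simp
qed simp

definition QS_to_RenQSym :: "(nat list \<Rightarrow> 'k::comm_ring_1) \<Rightarrow> 'k pt" where
  "QS_to_RenQSym u = pt_lincomb u {a. u a \<noteq> 0}"

lemma QS_to_RenQSym_eq:
  assumes "finite S" "{a. u a \<noteq> 0} \<subseteq> S"
  shows "QS_to_RenQSym u = pt_lincomb u S"
  unfolding QS_to_RenQSym_def pt_lincomb_def using assms
  by (intro ext sum.mono_neutral_left) auto

lemma QS_to_RenQSym_add:
  assumes "u \<in> QS" "v \<in> QS"
  shows "QS_to_RenQSym (\<lambda>w. u w + v w) = (\<lambda>m j. QS_to_RenQSym u m j + QS_to_RenQSym v m j)"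
proof -
  let ?S = "{a. u a \<noteq> 0} \<union> {a. v a \<noteq> 0}"
  have S: "finite ?S"
    using assms by (simp add: QS_def)
  have "{a. u a + v a \<noteq> 0} \<subseteq> ?S"
    by auto
  then show ?thesis
    by (simp add: QS_to_RenQSym_eq[OF S] pt_lincomb_def sum.distrib distrib_right)
qed

lemma QS_to_RenQSym_scale:
  assumes "u \<in> QS"
  shows "QS_to_RenQSym (\<lambda>w. c * u w) = (\<lambda>m j. c * QS_to_RenQSym u m j)"
proof -
  have S: "finite {a. u a \<noteq> 0}"
    using assms by (simp add: QS_def)
  have "{a. c * u a \<noteq> 0} \<subseteq> {a. u a \<noteq> 0}"
    by auto
  then show ?thesis
    by (simp add: QS_to_RenQSym_eq[OF S] pt_lincomb_def sum_distrib_left mult.assoc)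
qed

lemma QS_to_RenQSym_image: "QS_to_RenQSym ` QS = RenQSym"
proof (intro equalityI subsetI)
  fix x :: "'k::comm_ring_1 pt"
  assume "x \<in> RenQSym"
  then obtain c S where x: "x = pt_lincomb c S" and S: "finite S"
    by (auto simp: RenQSym_def)
  let ?c = "\<lambda>a. if a \<in> S then c a else 0"
  have "QS_to_RenQSym ?c = pt_lincomb ?c S"
    by (rule QS_to_RenQSym_eq[OF S]) auto
  also have "\<dots> = x"
    by (simp add: x pt_lincomb_def)
  finally have "x = QS_to_RenQSym ?c" ..
  moreover have "?c \<in> QS"
    using S by (simp add: QS_def)
  ultimately show "x \<in> QS_to_RenQSym ` QS"
    by (rule image_eqI)
qed (auto simp: RenQSym_def QS_def QS_to_RenQSym_def)

lemma qs_mult_nonzeroD: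
  assumes "qs_mult u v w \<noteq> 0"
  obtains a b where "u a \<noteq> 0" "v b \<noteq> 0" "w \<in># qsh a b"
proof -
  obtain a where a: "u a \<noteq> 0" "(\<Sum>b\<in>{b. v b \<noteq> 0}. u a * v b * of_nat (count (qsh a b) w)) \<noteq> 0"
    using assms unfolding qs_mult_def by (metis (mono_tags, lifting) mem_Collect_eq sum.neutral)
  then obtain b where b: "v b \<noteq> 0" "u a * v b * of_nat (count (qsh a b) w) \<noteq> 0"
    by (metis (mono_tags, lifting) mem_Collect_eq sum.neutral)
  then have "w \<in># qsh a b"
    by (metis count_eq_zero_iff mult_zero_right of_nat_0)
  then show ?thesis
    using that a b by blast
qed

lemma QS_to_RenQSym_qs_mult:
  assumes "u \<in> QS" "v \<in> QS"
  shows "QS_to_RenQSym (qs_mult u v) m j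
    = (\<Sum>a\<in>{a. u a \<noteq> 0}. \<Sum>b\<in>{b. v b \<noteq> 0}. u a * v b * (\<Sum>w\<in>#qsh a b. Mk w m j))"
proof -
  let ?A = "{a. u a \<noteq> 0}" and ?B = "{b. v b \<noteq> 0}"
  define W where "W = (\<Union>a\<in>?A. \<Union>b\<in>?B. set_mset (qsh a b))"
  have W: "finite W"
    using assms by (simp add: W_def QS_def)
  have "{w. qs_mult u v w \<noteq> 0} \<subseteq> W"
    by (auto simp: W_def elim!: qs_mult_nonzeroD)
  then have "QS_to_RenQSym (qs_mult u v) m j
      = (\<Sum>w\<in>W. \<Sum>a\<in>?A. \<Sum>b\<in>?B. u a * v b * (of_nat (count (qsh a b) w) * Mk w m j))"
    by (simp add: QS_to_RenQSym_eq[OF W] pt_lincomb_def qs_mult_def sum_distrib_right mult.assoc)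
  also have "\<dots> = (\<Sum>a\<in>?A. \<Sum>b\<in>?B. \<Sum>w\<in>W. u a * v b * (of_nat (count (qsh a b) w) * Mk w m j))"
    by (subst sum.swap) (intro sum.cong refl sum.swap)
  also have "\<dots> = (\<Sum>a\<in>?A. \<Sum>b\<in>?B. u a * v b * (\<Sum>w\<in>#qsh a b. Mk w m j))"
  proof (intro sum.cong refl)
    fix a b
    assume "a \<in> ?A" "b \<in> ?B"
    then have "set_mset (qsh a b) \<subseteq> W"
      by (auto simp: W_def)
    then show "(\<Sum>w\<in>W. u a * v b * (of_nat (count (qsh a b) w) * Mk w m j))
        = u a * v b * (\<Sum>w\<in>#qsh a b. Mk w m j)"
      by (simp add: sum_count_mult[OF W] flip: sum_distrib_left)
  qed
  finally show ?thesis .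
qed

section \<open>Extension of scalars and the isomorphism\<close>

context
  assumes containsQ: "\<forall>n::nat. 0 < n \<longrightarrow> (\<exists>y::'k::comm_ring_1. of_nat n * y = 1)"
begin

lemma of_int_has_inverse:
  assumes "b \<noteq> 0"
  shows "\<exists>y::'k. of_int b * y = 1"
proof -
  obtain y :: 'k where y: "of_int \<bar>b\<bar> * y = 1"
    using containsQ[rule_format, of "nat \<bar>b\<bar>"] assms by (auto simp: of_nat_nat)
  have "of_int b * (of_int (sgn b) * y) = of_int (b * sgn b) * y"
    by (simp add: mult.assoc)
  also have "\<dots> = 1"
    unfolding abs_sgn[symmetric] by (rule y)
  finally show ?thesis ..
qed

lemma of_int_mult_cancel:
  fixes x y :: 'k
  assumes "b \<noteq> 0" "of_int b * x = of_int b * y"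
  shows "x = y"
proof -
  obtain i :: 'k where i: "of_int b * i = 1"
    using of_int_has_inverse[OF assms(1)] by blast
  have "i * (of_int b * z) = z" for z
    using i by (metis mult.assoc mult.commute mult_1)
  then show ?thesis
    using assms(2) by metis
qed

lemma ratk_eqI:
  fixes y :: 'k
  assumes x: "x = of_int a / of_int b" and b: "b \<noteq> 0" and y: "of_int b * y = of_int a"
  shows "ratk x = y"
proof -
  obtain c d where quotient: "quotient_of x = (c, d)"
    by fastforce
  then have d: "d > 0" and "x = of_int c / of_int d"
    by (rule quotient_of_denom_pos, rule quotient_of_div)
  then have "of_int (a * d) = (of_int (c * b) :: rat)"
    using b x by (simp add: field_simps)
  then have cross: "a * d = c * b"
    by (simp only: of_int_eq_iff)
  define i :: 'k where "i = (THE y. of_int d * y = 1)"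
  have "\<exists>!y::'k. of_int d * y = 1"
    using of_int_has_inverse[of d] of_int_mult_cancel[of d] d by (metis less_irrefl)
  then have i: "of_int d * i = 1"
    unfolding i_def by (rule theI')
  have "of_int b * ratk x = of_int (c * b) * i"
    by (simp add: ratk_def quotient i_def mult_ac)
  also have "\<dots> = of_int a * (of_int d * i)"
    by (simp flip: cross)
  also have "\<dots> = of_int b * y"
    by (simp add: i y)
  finally show ?thesis
    using b by (rule of_int_mult_cancel[rotated])
qed

lemma ratk_fraction:
  obtains a b where "x = of_int a / of_int b" "b \<noteq> 0" "of_int b * ratk x = (of_int a :: 'k)"
proof -
  obtain a b where x: "x = of_int a / of_int b" "b \<noteq> 0"
    by (metis less_irrefl quotient_of_denom_pos quotient_of_div surj_pair)
  obtain i :: 'k where "of_int b * i = 1"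
    using of_int_has_inverse[OF x(2)] by blast
  then have "of_int b * (i * of_int a) = of_int a"
    by (simp flip: mult.assoc)
  then show ?thesis
    using x that ratk_eqI by metis
qed

interpretation ratk: ring_morphism "ratk :: rat \<Rightarrow> 'k"
proof
  show "ratk 1 = (1 :: 'k)"
    by (rule ratk_eqI[of 1 1 1]) simp_all
  fix x y :: rat
  obtain a b where x: "x = of_int a / of_int b" "b \<noteq> 0" "of_int b * ratk x = (of_int a :: 'k)"
    by (rule ratk_fraction)
  obtain c d where y: "y = of_int c / of_int d" "d \<noteq> 0" "of_int d * ratk y = (of_int c :: 'k)"
    by (rule ratk_fraction)
  show "ratk (x + y) = (ratk x + ratk y :: 'k)"
  proof (rule ratk_eqI)
    show "x + y = of_int (a * d + c * b) / of_int (b * d)"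
      using x y by (simp add: field_simps)
    have "of_int (b * d) * (ratk x + ratk y :: 'k)
        = of_int d * (of_int b * ratk x) + of_int b * (of_int d * ratk y)"
      by (simp add: algebra_simps)
    also have "\<dots> = of_int (a * d + c * b)"
      unfolding x(3) y(3) by (simp add: mult.commute)
    finally show "of_int (b * d) * (ratk x + ratk y) = (of_int (a * d + c * b) :: 'k)" .
  qed (use x y in simp)
  show "ratk (x * y) = (ratk x * ratk y :: 'k)"
  proof (rule ratk_eqI)
    show "x * y = of_int (a * c) / of_int (b * d)"
      using x y by simp
    have "of_int (b * d) * (ratk x * ratk y :: 'k) = (of_int b * ratk x) * (of_int d * ratk y)"
      by (simp add: algebra_simps)
    then show "of_int (b * d) * (ratk x * ratk y) = (of_int (a * c) :: 'k)"
      by (simp add: x(3) y(3))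
  qed (use x y in simp)
qed

lemma Mk_eq_coeff: "Mk a = (\<lambda>m. coeff (map_poly ratk (Mrat a m) :: 'k poly))"
  by (simp add: fun_eq_iff Mk_def coeff_map_poly ratk.zero)

text \<open>Evaluating at \<open>t = -1/2 - N\<close>, where \<open>N\<close> is the least length occurring in the relation,
  isolates a single coefficient.\<close>
lemma Mk_independent:
  fixes c :: "nat list \<Rightarrow> 'k"
  assumes S: "finite S" and relation: "\<And>m j. pt_lincomb c S m j = 0"
  shows "\<forall>a\<in>S. c a = 0"
proof (rule ccontr)
  assume "\<not> (\<forall>a\<in>S. c a = 0)"
  then obtain a where a: "a \<in> S" "c a \<noteq> 0"
    and min: "\<And>b. b \<in> S \<Longrightarrow> c b \<noteq> 0 \<Longrightarrow> length a \<le> length b"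
    using ex_has_least_nat[of "\<lambda>a. a \<in> S \<and> c a \<noteq> 0" _ length] by blast
  define m where "m = leading_monom a"
  define x :: rat where "x = - 1 / 2 - of_nat (length a)"
  have "(\<Sum>b\<in>S. smult (c b) (map_poly ratk (Mrat b m))) = 0"
    using relation by (simp add: poly_eq_iff coeff_sum pt_lincomb_def Mk_eq_coeff)
  then have "0 = poly (\<Sum>b\<in>S. smult (c b) (map_poly ratk (Mrat b m))) (ratk x)"
    by simp
  also have "\<dots> = (\<Sum>b\<in>S. c b * ratk (poly (Mrat b m) x))"
    by (simp add: poly_sum ratk.poly_map_poly)
  also have "\<dots> = (\<Sum>b\<in>S. if b = a then c a else 0)"
  proof (intro sum.cong refl)
    fix b
    assume "b \<in> S"
    then have "c b = 0 \<or> poly (Mrat b m) x = (if a = b then 1 else 0)"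
      unfolding m_def x_def using min poly_Mrat_leading_monom by blast
    then show "c b * ratk (poly (Mrat b m) x) = (if b = a then c a else 0)"
      by (auto simp: ratk.zero ratk.one)
  qed
  also have "\<dots> = c a"
    using S a by simp
  finally show False
    using a by simp
qed

lemma Mk_Nil: "Mk [] = (pt_one :: 'k pt)"
proof -
  have "Mrat [] m = (if m = 0 then 1 else 0)" for m
    using Mrat_append_zeros[of "[]" 0 m] by (simp add: idx_set_Nil gchoose_poly_def)
  then show ?thesis
    by (simp add: fun_eq_iff Mk_def pt_one_def ratk.zero ratk.one)
qed

lemma pt_mult_Mk: "pt_mult (Mk a) (Mk b) m j = (\<Sum>w\<in>#qsh a b. Mk w m j :: 'k)"
proof -
  have "pt_mult (Mk a) (Mk b) m j =
      (ratk (coeff (\<Sum>p\<in>{(m1, m2). m1 + m2 = m}. Mrat a (fst p) * Mrat b (snd p)) j) :: 'k)"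
    unfolding Mk_eq_coeff pt_mult_coeff ratk.map_poly_mult[symmetric] ratk.map_poly_sum[symmetric]
    by (simp add: coeff_map_poly ratk.zero)
  also have "\<dots> = ratk (coeff (\<Sum>w\<in>#qsh a b. Mrat w m) j)"
    by (simp only: Mrat_mult)
  also have "\<dots> = (\<Sum>w\<in>#qsh a b. Mk w m j)"
    unfolding Mk_def by (rule sum_mset_hom) (simp_all add: ratk.zero ratk.add)
  finally show ?thesis .
qed

lemma bij_betw_QS_to_RenQSym: "bij_betw QS_to_RenQSym QS (RenQSym :: 'k pt set)"
proof (rule bij_betw_imageI[OF inj_onI QS_to_RenQSym_image])
  fix u v :: "nat list \<Rightarrow> 'k"
  assume uv: "u \<in> QS" "v \<in> QS" "QS_to_RenQSym u = QS_to_RenQSym v"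
  let ?S = "{a. u a \<noteq> 0} \<union> {a. v a \<noteq> 0}"
  have S: "finite ?S"
    using uv by (simp add: QS_def)
  have "QS_to_RenQSym u = pt_lincomb u ?S" "QS_to_RenQSym v = pt_lincomb v ?S"
    by (rule QS_to_RenQSym_eq[OF S], simp)+
  then have eq: "pt_lincomb u ?S = pt_lincomb v ?S"
    using uv(3) by (simp only:)
  have "pt_lincomb (\<lambda>a. u a - v a) ?S m j = pt_lincomb u ?S m j - pt_lincomb v ?S m j" for m j
    by (simp add: pt_lincomb_def sum_subtractf left_diff_distrib)
  then have "pt_lincomb (\<lambda>a. u a - v a) ?S m j = 0" for m j
    by (simp only: eq diff_self)
  then have zero: "\<forall>a\<in>?S. u a - v a = 0"
    by (rule Mk_independent[OF S])
  show "u = v"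
  proof
    fix a
    show "u a = v a"
    proof (cases "a \<in> ?S")
      case True
      with zero have "u a - v a = 0" ..
      then show ?thesis
        by simp
    qed simp
  qed
qed

lemma QS_to_RenQSym_mult:
  fixes u v :: "nat list \<Rightarrow> 'k"
  assumes "u \<in> QS" "v \<in> QS"
  shows "QS_to_RenQSym (qs_mult u v) = pt_mult (QS_to_RenQSym u) (QS_to_RenQSym v)"
proof (intro ext)
  fix m j
  show "QS_to_RenQSym (qs_mult u v) m j = pt_mult (QS_to_RenQSym u) (QS_to_RenQSym v) m j"
    unfolding QS_to_RenQSym_qs_mult[OF assms]
    by (simp only: QS_to_RenQSym_def pt_lincomb_def pt_mult_sum pt_mult_Mk)
qed

lemma QS_to_RenQSym_one: "QS_to_RenQSym qs_one = (pt_one :: 'k pt)"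
proof -
  have "QS_to_RenQSym qs_one = (pt_lincomb qs_one {[]} :: 'k pt)"
    by (rule QS_to_RenQSym_eq) (auto simp: qs_one_def)
  then show ?thesis
    by (simp add: pt_lincomb_def qs_one_def Mk_Nil)
qed

end

theorem theorem5p11:
  fixes ty :: "'k::comm_ring_1 itself"
  assumes containsQ: "\<forall>n::nat. 0 < n \<longrightarrow> (\<exists>y::'k. of_nat n * y = 1)"
  shows "(\<forall>x \<in> (RenQSym :: 'k pt set). \<exists>!c :: nat list \<Rightarrow> 'k.
            finite {a. c a \<noteq> 0} \<and> x = pt_lincomb c {a. c a \<noteq> 0})
       \<and> (\<exists>\<Phi> :: (nat list \<Rightarrow> 'k) \<Rightarrow> 'k pt.
            bij_betw \<Phi> QS RenQSym
          \<and> (\<forall>u\<in>QS. \<forall>v\<in>QS. \<Phi> (\<lambda>w. u w + v w) = (\<lambda>m j. \<Phi> u m j + \<Phi> v m j))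
          \<and> (\<forall>c. \<forall>u\<in>QS. \<Phi> (\<lambda>w. c * u w) = (\<lambda>m j. c * \<Phi> u m j))
          \<and> (\<forall>u\<in>QS. \<forall>v\<in>QS. \<Phi> (qs_mult u v) = pt_mult (\<Phi> u) (\<Phi> v))
          \<and> \<Phi> qs_one = pt_one)"
proof (intro conjI ballI exI[of _ "QS_to_RenQSym :: (nat list \<Rightarrow> 'k) \<Rightarrow> 'k pt"] allI)
  show bij: "bij_betw (QS_to_RenQSym :: (nat list \<Rightarrow> 'k) \<Rightarrow> 'k pt) QS RenQSym"
    by (rule bij_betw_QS_to_RenQSym[OF containsQ])
  fix x :: "'k pt"
  assume "x \<in> RenQSym"
  then have "\<exists>!c. c \<in> QS \<and> x = QS_to_RenQSym c"
    using bij by (fastforce simp: bij_betw_def inj_on_def)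
  then show "\<exists>!c. finite {a. c a \<noteq> 0} \<and> x = pt_lincomb c {a. c a \<noteq> 0}"
    by (simp add: QS_def QS_to_RenQSym_def)
qed (simp_all add: QS_to_RenQSym_add QS_to_RenQSym_scale QS_to_RenQSym_mult[OF containsQ]
    QS_to_RenQSym_one[OF containsQ])

end
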